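(* Let $d\ge 1$ and let $A,B\subset\mathbb{R}^d$ be uniformly discrete sets. Let $\mu\in\mathcal{S}'(\mathbb{R}^d)$ be a tempered distribution whose Wigner transform satisfies $$W(\mu)=\sum_{(r,s)\in A\times B} c_{r,s}\,\delta_{(r,s)}$$ for some complex numbers $c_{r,s}$. Then $\mu$ and its Fourier transform $\widehat{\mu}$ are measures, with $\operatorname{supp}\mu\subset A$ and $\operatorname{supp}\widehat{\mu}\subset B$.
   Context: A set $A\subset\mathbb{R}^d$ is uniformly discrete if there is $\delta>0$ such that $|r-s|\ge\delta$ for all $r,s\in A$ with $r\ne s$. $\delta_\xi$ denotes the point mass (Dirac measure) at $\xi$; the series for $W(\mu)$ is understood as an identity of tempered distributions on $\mathbb{R}^{2d}$. A tempered distribution is called a measure if it is given by a locally finite complex Borel measure. The Fourier transform is $\widehat f(\omega)=\int_{\mathbb{R}^d} f(t)e^{-2\pi i\omega t}\,dt$ (with $\omega t$ the inner product), extended to $\mathcal{S}'(\mathbb{R}^d)$. The bracket $\langle\cdot,\cdot\rangle$ is the extension to $\mathcal{S}'\times\mathcal{S}$ of the inner product $\langle f,g\rangle=\int f\overline{g}$. For $f,g\in L^2(\mathbb{R}^d)$ the cross-Wigner distribution is $$W(f,g)(x,\omega)=\int_{\mathbb{R}^d} f\left(x+\tfrac t2\right)\overline{g\left(x-\tfrac t2\right)}e^{-2\pi i\omega t}\,dt,\qquad x,\omega\in\mathbb{R}^d.$$ For $\mu,\nu\in\mathcal{S}'(\mathbb{R}^d)$ it is extended by $\langle W(\mu,\nu),\phi\rangle=\langle\mu\otimes\overline{\nu},\mathcal{T}_s^{-1}\mathcal{F}_2^{-1}\phi\rangle$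 for $\phi\in\mathcal{S}(\mathbb{R}^{2d})$, where $\mathcal{F}_2F(x,\omega)=\int_{\mathbb{R}^d}F(x,t)e^{-2\pi i\omega t}\,dt$ and $\mathcal{T}_sF(x,t)=F(x+\frac t2,x-\frac t2)$. The Wigner transform of $\mu$ is $W(\mu):=W(\mu,\mu)\in\mathcal{S}'(\mathbb{R}^{2d})$. *)

theory Defs
  imports "HOL-Analysis.Analysis"
begin

text \<open>
  \<open>\<real>\<^sup>d\<close> is an arbitrary Euclidean space \<^typ>\<open>'a::euclidean_space\<close> (whose dimension
  is a positive integer), and \<open>\<real>\<^sup>2\<^sup>d\<close> is the product \<^typ>\<open>'a \<times> 'a\<close>.
  All distributions are complex-valued.
\<close>

section \<open>Schwartz functions and tempered distributions\<close>

text \<open>\<open>partials [v\<^sub>1, \<dots>, v\<^sub>m] f\<close> is \<open>\<partial>\<^bsub>v\<^sub>1\<^esub> \<cdots> \<partial>\<^bsub>v\<^sub>m\<^esub> f\<close>.  Lists of basis vectors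
  play the role of multi-indices.\<close>

primrec partials :: "'a::euclidean_space list \<Rightarrow> ('a \<Rightarrow> complex) \<Rightarrow> 'a \<Rightarrow> complex" where
  "partials [] f = f"
| "partials (v # vs) f = (\<lambda>x. frechet_derivative (partials vs f) (at x) v)"

definition smooth :: "('a::euclidean_space \<Rightarrow> complex) \<Rightarrow> bool" where
  "smooth f \<longleftrightarrow> (\<forall>vs\<in>lists Basis. partials vs f differentiable_on UNIV)"

definition schwartz :: "('a::euclidean_space \<Rightarrow> complex) \<Rightarrow> bool" where
  "schwartz f \<longleftrightarrow> smooth f \<and>
     (\<forall>k::nat. \<forall>vs\<in>lists Basis. bounded (range (\<lambda>x. norm x ^ k * cmod (partials vs f x))))"

definition schwartz_seminorm ::
    "nat \<Rightarrow> 'a::euclidean_space list \<Rightarrow> ('a \<Rightarrow> complex) \<Rightarrow> real" where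
  "schwartz_seminorm k vs f = (SUP x. norm x ^ k * cmod (partials vs f x))"

text \<open>A tempered distribution \<open>T\<close> is represented by \<open>\<phi> \<mapsto> \<langle>T, \<phi>\<rangle>\<close>, where the bracket extends
  \<open>\<langle>f, g\<rangle> = \<integral> f g\<^sup>*\<close> (with \<open>g\<^sup>*\<close> the complex conjugate) and is therefore \<^emph>\<open>antilinear\<close> in the
  test function.  Only the values on Schwartz functions are meaningful.  Continuity with
  respect to the Schwartz topology is expressed by a bound in terms of finitely many of the
  defining seminorms.\<close>

type_synonym 'a distr = "('a \<Rightarrow> complex) \<Rightarrow> complex"

definition tempered :: "'a::euclidean_space distr \<Rightarrow> bool" where
  "tempered T \<longleftrightarrow>
     (\<forall>\<phi> \<psi>. schwartz \<phi> \<longrightarrow> schwartz \<psi> \<longrightarrow> T (\<lambda>x. \<phi> x + \<psi> x) = T \<phi> + T \<psi>) \<and>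
     (\<forall>c \<phi>. schwartz \<phi> \<longrightarrow> T (\<lambda>x. c * \<phi> x) = cnj c * T \<phi>) \<and>
     (\<exists>C N. \<forall>\<phi>. schwartz \<phi> \<longrightarrow>
        cmod (T \<phi>) \<le>
          C * (\<Sum>k\<le>N. \<Sum>vs | set vs \<subseteq> Basis \<and> length vs \<le> N. schwartz_seminorm k vs \<phi>))"

definition dirac :: "'a::euclidean_space \<Rightarrow> 'a distr" where
  "dirac \<xi> = (\<lambda>\<phi>. cnj (\<phi> \<xi>))"

text \<open>\<open>T = \<Sum>i\<in>I. F i\<close> with (unconditional) convergence of the series in the weak-* sense,
  that is, after pairing with each Schwartz function.\<close>

definition distr_has_sum :: "('i \<Rightarrow> 'a::euclidean_space distr) \<Rightarrow> 'a distr \<Rightarrow> 'i set \<Rightarrow> bool" where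
  "distr_has_sum F T I \<longleftrightarrow> (\<forall>\<phi>. schwartz \<phi> \<longrightarrow> ((\<lambda>i. F i \<phi>) has_sum T \<phi>) I)"

section \<open>Fourier transform\<close>

definition fourier :: "('a::euclidean_space \<Rightarrow> complex) \<Rightarrow> 'a \<Rightarrow> complex" where
  "fourier f \<omega> = (\<integral>t. f t * exp (- 2 * of_real pi * \<i> * of_real (\<omega> \<bullet> t)) \<partial>lborel)"

definition inv_fourier :: "('a::euclidean_space \<Rightarrow> complex) \<Rightarrow> 'a \<Rightarrow> complex" where
  "inv_fourier f x = fourier f (- x)"

text \<open>As the bracket extends the inner product of \<open>L\<^sup>2\<close>, Parseval's identity reads
  \<open>\<langle>\<F> f, \<phi>\<rangle> = \<langle>f, \<F>\<inverse> \<phi>\<rangle>\<close>, which is how \<open>\<F>\<close> extends to tempered distributions.\<close>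

definition fourier_distr :: "'a::euclidean_space distr \<Rightarrow> 'a distr" where
  "fourier_distr T = (\<lambda>\<phi>. T (inv_fourier \<phi>))"

section \<open>Wigner transform\<close>

definition conj_distr :: "'a::euclidean_space distr \<Rightarrow> 'a distr" where
  "conj_distr T = (\<lambda>\<phi>. cnj (T (\<lambda>x. cnj (\<phi> x))))"

text \<open>The inner pairing contributes the conjugate of \<open>\<Phi>(x, \<cdot>)\<close>, so it has to be conjugated
  again before it is used as a test function in \<open>x\<close>; see \<open>tensor_distr_product\<close> below.\<close>

definition tensor_distr ::
    "'a::euclidean_space distr \<Rightarrow> 'b::euclidean_space distr \<Rightarrow> ('a \<times> 'b) distr" where
  "tensor_distr S T = (\<lambda>\<Phi>. S (\<lambda>x. cnj (T (\<lambda>y. \<Phi> (x, y)))))"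

lemma tensor_distr_product:
  assumes "tempered S" "tempered T" "schwartz \<phi>" "schwartz \<psi>"
  shows "tensor_distr S T (\<lambda>(x, y). \<phi> x * \<psi> y) = S \<phi> * T \<psi>"
proof -
  have T: "T (\<lambda>y. \<phi> x * \<psi> y) = cnj (\<phi> x) * T \<psi>" for x
    using assms(2,4) by (simp add: tempered_def)
  have S: "S (\<lambda>x. cnj (T \<psi>) * \<phi> x) = cnj (cnj (T \<psi>)) * S \<phi>"
    using assms(1,3) unfolding tempered_def by blast
  show ?thesis
    using S by (simp add: tensor_distr_def T mult.commute)
qed

definition sym_coord :: "('a::euclidean_space \<times> 'a \<Rightarrow> complex) \<Rightarrow> 'a \<times> 'a \<Rightarrow> complex" where
  "sym_coord F = (\<lambda>(x, t). F (x + t /\<^sub>R 2, x - t /\<^sub>R 2))"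

definition inv_sym_coord :: "('a::euclidean_space \<times> 'a \<Rightarrow> complex) \<Rightarrow> 'a \<times> 'a \<Rightarrow> complex" where
  "inv_sym_coord G = (\<lambda>(y, z). G ((y + z) /\<^sub>R 2, y - z))"

lemma sym_coord_inv_sym_coord: "sym_coord (inv_sym_coord G) = G"
  by (auto simp: sym_coord_def inv_sym_coord_def fun_eq_iff simp flip: scaleR_add_left scaleR_2)

lemma inv_sym_coord_sym_coord: "inv_sym_coord (sym_coord F) = F"
proof -
  have "(y + z) /\<^sub>R 2 + (y - z) /\<^sub>R 2 = y" "(y + z) /\<^sub>R 2 - (y - z) /\<^sub>R 2 = z" for y z :: 'a
    by (simp_all add: scaleR_diff_right scaleR_add_right flip: scaleR_add_left)
  then show ?thesis
    by (auto simp: sym_coord_def inv_sym_coord_def fun_eq_iff)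
qed

definition inv_fourier_snd :: "('a::euclidean_space \<times> 'a \<Rightarrow> complex) \<Rightarrow> 'a \<times> 'a \<Rightarrow> complex" where
  "inv_fourier_snd \<Phi> = (\<lambda>(x, t). inv_fourier (\<lambda>\<omega>. \<Phi> (x, \<omega>)) t)"

definition cross_wigner :: "'a::euclidean_space distr \<Rightarrow> 'a distr \<Rightarrow> ('a \<times> 'a) distr" where
  "cross_wigner \<mu> \<nu> =
     (\<lambda>\<Phi>. tensor_distr \<mu> (conj_distr \<nu>) (inv_sym_coord (inv_fourier_snd \<Phi>)))"

definition wigner :: "'a::euclidean_space distr \<Rightarrow> ('a \<times> 'a) distr" where
  "wigner \<mu> = cross_wigner \<mu> \<mu>"

section \<open>Support, and distributions given by measures\<close>

definition test_function :: "('a::euclidean_space \<Rightarrow> complex) \<Rightarrow> bool" where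
  "test_function \<phi> \<longleftrightarrow> smooth \<phi> \<and> compact (closure {x. \<phi> x \<noteq> 0})"

definition distr_support :: "'a::euclidean_space distr \<Rightarrow> 'a set" where
  "distr_support T =
     - \<Union>{U. open U \<and> (\<forall>\<phi>. test_function \<phi> \<and> closure {x. \<phi> x \<noteq> 0} \<subseteq> U \<longrightarrow> T \<phi> = 0)}"

text \<open>A locally finite complex Borel measure may have infinite total variation (such as
  \<open>\<Sum>n. (-1)\<^sup>n \<delta>\<^sub>n\<close>), hence it is a countably additive set function on the \<^emph>\<open>bounded\<close> Borel
  sets; values on other sets are irrelevant.\<close>

definition locally_finite_complex_measure :: "('a::euclidean_space set \<Rightarrow> complex) \<Rightarrow> bool" where
  "locally_finite_complex_measure \<nu> \<longleftrightarrow>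
     (\<forall>E::nat \<Rightarrow> 'a set. range E \<subseteq> sets borel \<and> disjoint_family E \<and> bounded (\<Union>i. E i) \<longrightarrow>
        (\<lambda>i. \<nu> (E i)) sums \<nu> (\<Union>i. E i))"

text \<open>\<open>d\<nu> = h d|\<nu>|\<close> with \<open>|h| = 1\<close> and \<open>|\<nu>|\<close> the total variation measure of \<open>\<nu>\<close>; integration
  against \<open>\<nu>\<close> is integration of the product with \<open>h\<close> against \<open>|\<nu>|\<close>.\<close>

definition polar_decomposition ::
    "('a::euclidean_space set \<Rightarrow> complex) \<Rightarrow> 'a measure \<Rightarrow> ('a \<Rightarrow> complex) \<Rightarrow> bool" where
  "polar_decomposition \<nu> M h \<longleftrightarrow>
     sets M = sets borel \<and> (\<forall>K. compact K \<longrightarrow> emeasure M K < \<infinity>) \<and>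
     h \<in> borel_measurable borel \<and> (\<forall>x. cmod (h x) = 1) \<and>
     (\<forall>E\<in>sets borel. bounded E \<longrightarrow> \<nu> E = (LINT x:E|M. h x))"

text \<open>The pairing with \<open>\<nu>\<close> is tested on compactly supported functions, since a Schwartz function
  need not be integrable against \<open>|\<nu>|\<close>; by density this determines a tempered distribution.\<close>

definition given_by_measure ::
    "'a::euclidean_space distr \<Rightarrow> ('a set \<Rightarrow> complex) \<Rightarrow> bool" where
  "given_by_measure T \<nu> \<longleftrightarrow>
     (\<exists>M h. polar_decomposition \<nu> M h \<and>
        (\<forall>\<phi>. test_function \<phi> \<longrightarrow> T \<phi> = (\<integral>x. cnj (\<phi> x) * h x \<partial>M)))"

definition is_measure_distr :: "'a::euclidean_space distr \<Rightarrow> bool" where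
  "is_measure_distr T \<longleftrightarrow> (\<exists>\<nu>. locally_finite_complex_measure \<nu> \<and> given_by_measure T \<nu>)"

end

theory Submission
  imports
    Defs
    "HOL-Computational_Algebra.Polynomial"
    "HOL-Probability.Characteristic_Functions"
    "HOL-Probability.Sinc_Integral"
begin

text \<open>
  The cross-Wigner transforms of \<open>f\<close> and \<open>g\<close> are the test functions on which the Wigner transform
  of a distribution factorizes: \<open>\<langle>W(\<mu>), W(f, g)\<rangle> = \<langle>\<mu>, f\<rangle> \<langle>\<mu>, g\<rangle>\<^sup>*\<close> (\<open>wigner_rank_one\<close>).  Since
  \<open>W(\<mu>)\<close> is carried by \<open>A \<times> B\<close>, the right-hand side depends only on the restriction of \<open>W(f, g)\<close> to
  \<open>A \<times> B\<close>.  For fixed \<open>a\<close>, the function \<open>W(f, g)(a, \<cdot>)\<close> is the Fourier transform of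
  \<open>t \<mapsto> f(a + t/2) g(a - t/2)\<^sup>*\<close>, so that \<open>\<langle>\<mu>, f\<rangle> \<langle>\<mu>, g\<rangle>\<^sup>*\<close> depends only on the symmetric products
  \<open>f(a + t) g(a - t)\<^sup>*\<close> with \<open>a \<in> A\<close>.  The Wigner transform of \<open>\<mu>\<close>'s Fourier transform is that of \<open>\<mu>\<close>
  rotated by a right angle in the plane of position and frequency; therefore the Fourier transform
  of \<open>\<mu>\<close> has the same property with \<open>B\<close> in place of \<open>A\<close>.  The two halves of the theorem thus follow
  from one statement about an antilinear functional \<open>u\<close> on test functions with this property.

  Such a functional vanishes on functions supported in a ball that misses \<open>A\<close>: if \<open>a + t\<close> and \<open>a - t\<close>
  lie in the ball then so does \<open>a\<close>, hence all symmetric products of \<open>f\<close> with itself are zero and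
  \<open>\<bar>u(f)\<bar>\<^sup>2 = 0\<close>.  Near a point \<open>p\<close> of \<open>A\<close>, which is isolated, only the symmetry about \<open>p\<close> matters.
  Therefore a smooth factor \<open>m\<close> can be moved from \<open>f\<close> to \<open>g\<close> by reflecting and conjugating it, and
  comparing with a fixed \<open>g\<close> shows that multiplication by \<open>m\<close> acts on \<open>u\<close> as a scalar
  (\<open>multiplier_eigenvalue\<close>).  A derivative of a point mass does not have this property.  Indeed, let
  \<open>f(p) = 0\<close> and let \<open>\<kappa>\<close> be the scalar of \<open>f\<close>.  If \<open>\<kappa> \<noteq> 0\<close>, then \<open>f - \<kappa>\<^sup>*\<close> annihilates \<open>u\<close> near \<open>p\<close>
  and is invertible there, so \<open>u\<close> is zero near \<open>p\<close>; if \<open>\<kappa> = 0\<close>, then \<open>u(f) = 0\<close> at once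
  (\<open>null_near_isolated_point\<close>).  A partition of unity shows that \<open>u(f)\<close> depends on the values of \<open>f\<close>
  on \<open>A\<close> alone, which makes \<open>u\<close> a combination of point masses (\<open>combination_of_point_masses\<close>).  As
  bounded sets contain finitely many points of \<open>A\<close>, the combination is a locally finite measure.

  The factorization applies only if \<open>W(f, g)\<close> is a Schwartz function whose inverse partial Fourier
  transform is the symmetric product of \<open>f\<close> and \<open>g\<close>.  The first sections supply this: partial
  Fourier transforms of test functions are Schwartz functions (\<open>partial_fourier_schwartz\<close>), and
  Fourier inversion holds for test functions (\<open>fourier_inversion\<close>).
\<close>

section \<open>Smooth functions\<close>

definition partial :: "'a::euclidean_space \<Rightarrow> ('a \<Rightarrow> complex) \<Rightarrow> 'a \<Rightarrow> complex" where
  "partial v f = (\<lambda>x. frechet_derivative f (at x) v)"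

lemma partial_eqI:
  assumes "\<And>x. (f has_derivative f' x) (at x)"
  shows "partial v f = (\<lambda>x. f' x v)"
  unfolding partial_def by (simp add: frechet_derivative_at[OF assms, symmetric])

lemma partials_snoc: "partials (vs @ [v]) f = partials vs (partial v f)"
  by (induction vs) (simp_all add: partial_def)

text \<open>Coinduction avoids all formulas for iterated derivatives: it is enough to exhibit a class of
  differentiable functions that contains its own partial derivatives.\<close>

lemma smooth_coinduct:
  assumes "f \<in> S"
    and "\<And>f. f \<in> S \<Longrightarrow> f differentiable_on UNIV"
    and "\<And>f v. f \<in> S \<Longrightarrow> v \<in> Basis \<Longrightarrow> partial v f \<in> S"
  shows "smooth f"
proof -
  have "partials vs f \<in> S" if "set vs \<subseteq> Basis" "f \<in> S" for vs f
    using that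
  proof (induction vs arbitrary: f rule: rev_induct)
    case (snoc v vs)
    then show ?case by (simp add: partials_snoc assms(3))
  qed simp
  then show ?thesis
    using assms(1,2) unfolding smooth_def by (meson in_listsD subsetI)
qed

lemma smooth_imp_differentiable: "smooth f \<Longrightarrow> f differentiable (at x)"
  unfolding smooth_def differentiable_on_def
  by (metis UNIV_I lists.Nil partials.simps(1))

lemma smooth_partial:
  assumes "smooth f" "v \<in> Basis"
  shows "smooth (partial v f)"
  unfolding smooth_def
proof
  fix vs :: "'a list" assume "vs \<in> lists Basis"
  then have "vs @ [v] \<in> lists Basis" using assms by auto
  then show "partials vs (partial v f) differentiable_on UNIV"
    using assms unfolding smooth_def by (metis partials_snoc)
qed

lemma smooth_continuous_on: "smooth f \<Longrightarrow> continuous_on S f"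
  using smooth_imp_differentiable
  by (metis continuous_at_imp_continuous_on differentiable_imp_continuous_within)

lemma smooth_isCont: "smooth f \<Longrightarrow> isCont f x"
  using smooth_imp_differentiable differentiable_imp_continuous_within by blast

text \<open>Differentiability \<open>k + 1\<close> times.  Unlike smoothness, this notion is recursive in \<open>k\<close>, so that
  closure properties of smooth functions follow by induction from the rules of
  differentiation.\<close>

primrec diffble :: "nat \<Rightarrow> ('a::euclidean_space \<Rightarrow> complex) \<Rightarrow> bool" where
  "diffble 0 f \<longleftrightarrow> (\<forall>x. f differentiable (at x))"
| "diffble (Suc k) f \<longleftrightarrow> (\<forall>x. f differentiable (at x)) \<and> (\<forall>v\<in>Basis. diffble k (partial v f))"

lemma diffble_differentiable: "diffble k f \<Longrightarrow> f differentiable (at x)"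
  by (cases k) auto

lemma diffble_has_derivative:
  "diffble k f \<Longrightarrow> (f has_derivative (\<lambda>v. partial v f x)) (at x)"
  unfolding partial_def using diffble_differentiable frechet_derivative_works by metis

lemma smooth_has_derivative:
  "smooth f \<Longrightarrow> (f has_derivative (\<lambda>v. partial v f x)) (at x)"
  unfolding partial_def using smooth_imp_differentiable frechet_derivative_works by metis

lemma diffble_SucD: "diffble (Suc k) f \<Longrightarrow> diffble k f"
  by (induction k arbitrary: f) auto

lemma smooth_iff_diffble: "smooth f \<longleftrightarrow> (\<forall>k. diffble k f)"
proof
  assume "smooth f"
  have "diffble k f" if "smooth f" for k f
    using that
    by (induction k arbitrary: f) (auto simp: smooth_imp_differentiable smooth_partial)
  then show "\<forall>k. diffble k f" using \<open>smooth f\<close> by blast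
next
  assume "\<forall>k. diffble k f"
  then have "f \<in> {f. \<forall>k. diffble k f}" by simp
  then show "smooth f"
  proof (rule smooth_coinduct)
    fix g :: "'a \<Rightarrow> complex" and v :: 'a
    assume "g \<in> {f. \<forall>k. diffble k f}" "v \<in> Basis"
    then have "diffble (Suc k) g" for k by blast
    then show "partial v g \<in> {f. \<forall>k. diffble k f}" using \<open>v \<in> Basis\<close> by auto
  next
    fix g :: "'a \<Rightarrow> complex"
    assume "g \<in> {f. \<forall>k. diffble k f}"
    then have "diffble 0 g" by blast
    then show "g differentiable_on UNIV" by (auto simp: differentiable_on_def)
  qed
qed

lemma diffble_const: "diffble k (\<lambda>x. c)"
proof (induction k arbitrary: c)
  case (Suc k)
  have "partial v (\<lambda>x::'a. c) = (\<lambda>x. 0)" for v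
    by (rule partial_eqI) auto
  with Suc show ?case by simp
qed simp

lemma diffble_add:
  "diffble k f \<Longrightarrow> diffble k g \<Longrightarrow> diffble k (\<lambda>x. f x + g x)"
proof (induction k arbitrary: f g)
  case (Suc k)
  have "partial v (\<lambda>x. f x + g x) = (\<lambda>x. partial v f x + partial v g x)" for v
    by (rule partial_eqI) (intro has_derivative_add diffble_has_derivative[OF Suc.prems(1)]
        diffble_has_derivative[OF Suc.prems(2)])
  with Suc show ?case by simp
qed simp

lemma diffble_mult:
  "diffble k f \<Longrightarrow> diffble k g \<Longrightarrow> diffble k (\<lambda>x. f x * g x)"
proof (induction k arbitrary: f g)
  case (Suc k)
  have "partial v (\<lambda>x. f x * g x) = (\<lambda>x. f x * partial v g x + partial v f x * g x)" for v
    by (rule partial_eqI) (intro has_derivative_mult diffble_has_derivative[OF Suc.prems(1)]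
        diffble_has_derivative[OF Suc.prems(2)])
  with Suc show ?case
    by (simp add: diffble_add diffble_SucD[OF Suc.prems(1)] diffble_SucD[OF Suc.prems(2)])
qed simp

lemma diffble_bounded_linear_left:
  assumes h: "bounded_linear h"
  shows "diffble k f \<Longrightarrow> diffble k (\<lambda>x. h (f x))"
proof (induction k arbitrary: f)
  case 0
  then show ?case
    by (auto intro: differentiable_compose[OF bounded_linear_imp_differentiable[OF h]])
next
  case (Suc k)
  have "partial v (\<lambda>x. h (f x)) = (\<lambda>x. h (partial v f x))" for v
    by (rule partial_eqI) (rule bounded_linear.has_derivative[OF h diffble_has_derivative[OF Suc.prems]])
  with Suc show ?case
    by (auto intro: differentiable_compose[OF bounded_linear_imp_differentiable[OF h]])
qed

text \<open>The derivative of \<open>1 / f\<close> is a product of a derivative of \<open>f\<close> and factors \<open>1 / f\<close>, to which the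
  induction hypothesis applies.\<close>

lemma diffble_inverse:
  assumes nz: "\<And>x. f x \<noteq> 0"
  shows "diffble k f \<Longrightarrow> diffble k (\<lambda>x. inverse (f x))"
proof (induction k)
  case (Suc k)
  have partial: "partial v (\<lambda>x. inverse (f x)) = (\<lambda>x. - (inverse (f x) * partial v f x * inverse (f x)))" for v
    by (rule partial_eqI) (rule Deriv.has_derivative_inverse[OF nz diffble_has_derivative[OF Suc.prems]])
  have "diffble k (\<lambda>x. inverse (f x))"
    using Suc.IH diffble_SucD[OF Suc.prems] by simp
  then have "diffble k (partial v (\<lambda>x. inverse (f x)))" if "v \<in> Basis" for v
    unfolding partial
    by (intro diffble_mult diffble_bounded_linear_left[OF bounded_linear_minus[OF bounded_linear_ident]])
       (use Suc.prems that in auto)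
  then show ?case using Suc.prems nz by (simp add: differentiable_inverse)
qed (simp add: nz differentiable_inverse)

lemma diffble_sum:
  "finite I \<Longrightarrow> (\<And>i. i \<in> I \<Longrightarrow> diffble k (f i)) \<Longrightarrow> diffble k (\<lambda>x. \<Sum>i\<in>I. f i x)"
  by (induction I rule: finite_induct) (auto simp: diffble_const diffble_add)

lemma partial_affine:
  fixes L :: "'b::euclidean_space \<Rightarrow> 'a::euclidean_space"
  assumes L: "linear L" and f: "diffble k f"
  shows "partial v (\<lambda>x. f (c + L x)) = (\<lambda>x. partial (L v) f (c + L x))"
proof (rule partial_eqI)
  fix x
  have "((\<lambda>x. c + L x) has_derivative L) (at x)"
    using L by (auto intro!: derivative_eq_intros linear_imp_has_derivative)
  from has_derivative_compose[OF this diffble_has_derivative[OF f]]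
  show "((\<lambda>x. f (c + L x)) has_derivative (\<lambda>v. partial (L v) f (c + L x))) (at x)" .
qed

lemma partial_euclidean_representation:
  assumes "diffble k f"
  shows "partial w f x = (\<Sum>b\<in>Basis. of_real (w \<bullet> b) * partial b f x)"
proof -
  interpret linear "\<lambda>v. partial v f x"
    by (rule has_derivative_linear[OF diffble_has_derivative[OF assms]])
  have "partial w f x = partial (\<Sum>b\<in>Basis. (w \<bullet> b) *\<^sub>R b) f x"
    by (simp add: euclidean_representation)
  also have "\<dots> = (\<Sum>b\<in>Basis. of_real (w \<bullet> b) * partial b f x)"
    by (simp only: sum scale scaleR_conv_of_real)
  finally show ?thesis .
qed

lemma diffble_affine:
  fixes L :: "'b::euclidean_space \<Rightarrow> 'a::euclidean_space"
  assumes L: "linear L"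
  shows "diffble k f \<Longrightarrow> diffble k (\<lambda>x. f (c + L x))"
proof (induction k arbitrary: f)
  case 0
  then have "((\<lambda>x. f (c + L x)) has_derivative (\<lambda>v. partial (L v) f (c + L x))) (at x)" for x
    by (intro has_derivative_compose[OF _ diffble_has_derivative[OF 0]])
       (use L in \<open>auto intro!: derivative_eq_intros linear_imp_has_derivative\<close>)
  then show ?case using differentiable_def by (auto simp: differentiable_def)
next
  case (Suc k)
  have "((\<lambda>x. f (c + L x)) has_derivative (\<lambda>v. partial (L v) f (c + L x))) (at x)" for x
    by (intro has_derivative_compose[OF _ diffble_has_derivative[OF Suc.prems]])
       (use L in \<open>auto intro!: derivative_eq_intros linear_imp_has_derivative\<close>)
  then have "(\<lambda>x. f (c + L x)) differentiable (at x)" for x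
    by (auto simp: differentiable_def)
  moreover have "diffble k (\<lambda>x. \<Sum>b\<in>Basis. of_real (L v \<bullet> b) * partial b f (c + L x))" for v
    by (intro diffble_sum diffble_mult diffble_const Suc.IH finite_Basis)
       (use Suc.prems in auto)
  moreover have "partial v (\<lambda>x. f (c + L x)) = (\<lambda>x. \<Sum>b\<in>Basis. of_real (L v \<bullet> b) * partial b f (c + L x))" for v
    unfolding partial_affine[OF L Suc.prems] by (rule ext) (rule partial_euclidean_representation[OF Suc.prems])
  ultimately show ?case by simp
qed

text \<open>All derivatives \<open>F n\<close> of the outer function are treated at once, because differentiating
  \<open>F n (g x)\<close> produces \<open>F (Suc n) (g x)\<close>.\<close>

lemma diffble_compose_real:
  fixes F :: "nat \<Rightarrow> real \<Rightarrow> complex" and g :: "'a::euclidean_space \<Rightarrow> real"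
  assumes F: "\<And>n x. (F n has_vector_derivative F (Suc n) x) (at x)"
  shows "diffble k (\<lambda>x. of_real (g x)) \<Longrightarrow> diffble k (\<lambda>x. F n (g x))"
proof (induction k arbitrary: n)
  case (0 n)
  have "((\<lambda>x. Re (of_real (g x))) has_derivative (\<lambda>v. Re (partial v (\<lambda>x. of_real (g x)) x))) (at x)" for x
    by (intro bounded_linear.has_derivative[OF bounded_linear_Re] diffble_has_derivative[OF 0])
  then have "(g has_derivative (\<lambda>v. Re (partial v (\<lambda>x. of_real (g x)) x))) (at x)" for x by simp
  from has_derivative_compose[OF this F[unfolded has_vector_derivative_def]]
  show ?case by (auto simp: differentiable_def)
next
  case (Suc k n)
  let ?g = "\<lambda>x. complex_of_real (g x)"
  have "((\<lambda>x. Re (?g x)) has_derivative (\<lambda>v. Re (partial v ?g x))) (at x)" for x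
    by (intro bounded_linear.has_derivative[OF bounded_linear_Re] diffble_has_derivative[OF Suc.prems])
  then have g: "(g has_derivative (\<lambda>v. Re (partial v ?g x))) (at x)" for x by simp
  have pdg: "of_real (Re (partial v ?g x)) = partial v ?g x" for v x
  proof -
    have "partial v ?g = (\<lambda>x. of_real (Re (partial v ?g x)))"
      by (rule partial_eqI) (rule bounded_linear.has_derivative[OF bounded_linear_of_real g])
    from fun_cong[OF this, of x] show ?thesis by (rule sym)
  qed
  have D: "((\<lambda>x. F n (g x)) has_derivative (\<lambda>v. Re (partial v ?g x) *\<^sub>R F (Suc n) (g x))) (at x)" for x
    by (rule has_derivative_compose[OF g F[unfolded has_vector_derivative_def]])
  have partial: "partial v (\<lambda>x. F n (g x)) = (\<lambda>x. partial v ?g x * F (Suc n) (g x))" for v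
  proof -
    have "partial v (\<lambda>x. F n (g x)) = (\<lambda>x. Re (partial v ?g x) *\<^sub>R F (Suc n) (g x))"
      by (rule partial_eqI) (rule D)
    also have "\<dots> = (\<lambda>x. partial v ?g x * F (Suc n) (g x))"
      unfolding scaleR_conv_of_real pdg ..
    finally show ?thesis .
  qed
  have "diffble k (partial v (\<lambda>x. F n (g x)))" if "v \<in> Basis" for v
    unfolding partial using Suc.prems that diffble_SucD[OF Suc.prems]
    by (intro diffble_mult Suc.IH) auto
  then show ?case using D by (auto simp: differentiable_def)
qed

lemma smooth_const: "smooth (\<lambda>x. c)"
  and smooth_add: "smooth f \<Longrightarrow> smooth g \<Longrightarrow> smooth (\<lambda>x. f x + g x)"
  and smooth_mult: "smooth f \<Longrightarrow> smooth g \<Longrightarrow> smooth (\<lambda>x. f x * g x)"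
  and smooth_bounded_linear_left: "bounded_linear h \<Longrightarrow> smooth f \<Longrightarrow> smooth (\<lambda>x. h (f x))"
  and smooth_inverse: "(\<And>x. f x \<noteq> 0) \<Longrightarrow> smooth f \<Longrightarrow> smooth (\<lambda>x. inverse (f x))"
  and smooth_sum: "finite I \<Longrightarrow> (\<And>i. i \<in> I \<Longrightarrow> smooth (F i)) \<Longrightarrow> smooth (\<lambda>x. \<Sum>i\<in>I. F i x)"
  for f g :: "'a::euclidean_space \<Rightarrow> complex" and F :: "'i \<Rightarrow> 'a \<Rightarrow> complex"
  by (simp_all add: smooth_iff_diffble diffble_const diffble_add diffble_mult
        diffble_bounded_linear_left diffble_inverse diffble_sum)

lemma smooth_affine: "linear L \<Longrightarrow> smooth f \<Longrightarrow> smooth (\<lambda>x. f (c + L x))"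
  by (simp add: smooth_iff_diffble diffble_affine)

lemma smooth_linear: "linear L \<Longrightarrow> smooth f \<Longrightarrow> smooth (\<lambda>x. f (L x))"
  using smooth_affine[where c=0] by simp

lemma smooth_compose_real:
  "\<lbrakk>\<And>n x. (F n has_vector_derivative F (Suc n) x) (at x); smooth (\<lambda>x. of_real (g x))\<rbrakk>
    \<Longrightarrow> smooth (\<lambda>x. F n (g x))"
  by (simp add: smooth_iff_diffble diffble_compose_real)

lemma smooth_cnj: "smooth f \<Longrightarrow> smooth (\<lambda>x. cnj (f x))"
  by (rule smooth_bounded_linear_left[OF bounded_linear_cnj])

lemma smooth_minus: "smooth f \<Longrightarrow> smooth (\<lambda>x. - f x)"
  by (rule smooth_bounded_linear_left[OF bounded_linear_minus[OF bounded_linear_ident]])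

lemma smooth_diff: "smooth f \<Longrightarrow> smooth g \<Longrightarrow> smooth (\<lambda>x. f x - g x)"
  using smooth_add[OF _ smooth_minus] by fastforce

lemma smooth_prod:
  "finite I \<Longrightarrow> (\<And>i. i \<in> I \<Longrightarrow> smooth (F i)) \<Longrightarrow> smooth (\<lambda>x. \<Prod>i\<in>I. F i x)"
  by (induction I rule: finite_induct) (auto simp: smooth_const smooth_mult)

lemma smooth_of_real_linear:
  fixes L :: "'a::euclidean_space \<Rightarrow> real"
  assumes L: "linear L"
  shows "smooth (\<lambda>x. of_real (L x))"
proof -
  have D: "((\<lambda>x. complex_of_real (L x)) has_derivative (\<lambda>v. of_real (L v))) (at x)" for x
    by (intro bounded_linear.has_derivative[OF bounded_linear_of_real] linear_imp_has_derivative L)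
  have "partial v (\<lambda>x. complex_of_real (L x)) = (\<lambda>x. of_real (L v))" for v
    by (rule partial_eqI) (rule D)
  then have "diffble (Suc k) (\<lambda>x. complex_of_real (L x))" for k
    using D by (auto simp: differentiable_def diffble_const)
  then show ?thesis using diffble_SucD smooth_iff_diffble by blast
qed

lemma partial_cmult: "smooth f \<Longrightarrow> partial v (\<lambda>x. c * f x) = (\<lambda>x. c * partial v f x)"
  by (rule partial_eqI) (auto intro!: derivative_eq_intros smooth_has_derivative)

lemma partial_linear: "linear L \<Longrightarrow> smooth f \<Longrightarrow> partial v (\<lambda>x. f (L x)) = (\<lambda>x. partial (L v) f (L x))"
  using partial_affine[where c=0 and k=0] smooth_imp_differentiable by fastforce

lemma smooth_partial_direction:
  assumes "smooth f"
  shows "smooth (partial w f)"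
proof -
  have "diffble 0 f" using assms by (simp add: smooth_iff_diffble)
  then have "partial w f = (\<lambda>x. \<Sum>b\<in>Basis. of_real (w \<bullet> b) * partial b f x)"
    by (intro ext partial_euclidean_representation)
  moreover have "smooth (\<lambda>x. \<Sum>b\<in>Basis. of_real (w \<bullet> b) * partial b f x)"
    using assms by (intro smooth_sum smooth_mult smooth_const smooth_partial) auto
  ultimately show ?thesis by simp
qed

lemma partial_minus_direction: "smooth f \<Longrightarrow> partial (- v) f x = - partial v f x"
  using has_derivative_linear[OF smooth_has_derivative] linear_neg by fastforce

section \<open>Test functions\<close>

lemma test_function_iff:
  "test_function f \<longleftrightarrow> smooth f \<and> (\<exists>R. \<forall>x. norm x > R \<longrightarrow> f x = 0)"
proof -
  have "compact (closure {x. f x \<noteq> 0}) \<longleftrightarrow> (\<exists>R. \<forall>x. norm x > R \<longrightarrow> f x = 0)"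
    unfolding compact_closure bounded_iff by (simp add: not_less[symmetric]) blast
  then show ?thesis by (simp add: test_function_def)
qed

lemma test_function_smooth: "test_function f \<Longrightarrow> smooth f"
  by (simp add: test_function_def)

lemma test_function_mult: "test_function f \<Longrightarrow> smooth g \<Longrightarrow> test_function (\<lambda>x. f x * g x)"
  and test_function_mult': "test_function f \<Longrightarrow> smooth g \<Longrightarrow> test_function (\<lambda>x. g x * f x)"
  by (auto simp: test_function_iff smooth_mult)

lemma test_function_add:
  "test_function f \<Longrightarrow> test_function g \<Longrightarrow> test_function (\<lambda>x. f x + g x)"
  unfolding test_function_iff
proof (elim conjE exE, intro conjI)
  fix R S assume "\<forall>x. norm x > R \<longrightarrow> f x = 0" "\<forall>x. norm x > S \<longrightarrow> g x = 0"
  then show "\<exists>R. \<forall>x. norm x > R \<longrightarrow> f x + g x = 0" by (intro exI[of _ "max R S"]) auto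
qed (simp add: smooth_add)

lemma test_function_zero: "test_function (\<lambda>x. 0)"
  by (auto simp: test_function_iff smooth_const)

lemma test_function_cnj: "test_function f \<Longrightarrow> test_function (\<lambda>x. cnj (f x))"
  by (auto simp: test_function_iff smooth_cnj)

lemma test_function_diff:
  "test_function f \<Longrightarrow> test_function g \<Longrightarrow> test_function (\<lambda>x. f x - g x)"
  using test_function_add[OF _ test_function_mult'[OF _ smooth_const[of "-1"]], of f g] by simp

lemma test_function_sum:
  "finite I \<Longrightarrow> (\<And>i. i \<in> I \<Longrightarrow> test_function (F i)) \<Longrightarrow> test_function (\<lambda>x. \<Sum>i\<in>I. F i x)"
  by (induction I rule: finite_induct) (auto simp: test_function_zero test_function_add)

lemma partial_zero_locally:
  assumes "open S" "x \<in> S" "\<And>y. y \<in> S \<Longrightarrow> f y = 0"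
  shows "partial v f x = 0"
proof -
  have "(f has_derivative (\<lambda>_. 0)) (at x)"
    by (rule has_derivative_transform_within_open[OF has_derivative_const assms(1,2)])
      (use assms(3) in simp)
  then show ?thesis unfolding partial_def by (simp add: frechet_derivative_at[symmetric])
qed

lemma test_function_partial:
  assumes "test_function f"
  shows "test_function (partial v f)"
proof -
  obtain R where R: "\<And>x. norm x > R \<Longrightarrow> f x = 0" using assms test_function_iff by metis
  have "open {x::'a. R < norm x}" by (intro open_Collect_less continuous_intros)
  then have "\<forall>x. norm x > R \<longrightarrow> partial v f x = 0"
    using R partial_zero_locally[of "{x. R < norm x}"] by blast
  then show ?thesis
    using assms by (auto simp: test_function_iff smooth_partial_direction)
qed

lemma test_function_bounded:
  assumes "test_function f"
  obtains M where "M > 0" "\<And>x. cmod (f x) \<le> M"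
proof -
  obtain R where R: "\<And>x. norm x > R \<Longrightarrow> f x = 0" using assms test_function_iff by metis
  have "compact (f ` cball 0 R)"
    using assms by (intro compact_continuous_image smooth_continuous_on) (auto simp: test_function_smooth)
  then obtain M where "M > 0" and M: "\<And>x. x \<in> cball 0 R \<Longrightarrow> cmod (f x) \<le> M"
    using compact_imp_bounded bounded_pos by (metis imageI)
  have "cmod (f x) \<le> M" for x
    using M[of x] R[of x] \<open>M > 0\<close> by (cases "norm x > R") auto
  then show ?thesis using \<open>M > 0\<close> that by blast
qed

section \<open>Schwartz functions\<close>

lemma schwartz_coinduct:
  assumes "f \<in> S"
    and diff: "\<And>f. f \<in> S \<Longrightarrow> f differentiable_on UNIV"
    and partial: "\<And>f v. f \<in> S \<Longrightarrow> v \<in> Basis \<Longrightarrow> partial v f \<in> S"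
    and bd: "\<And>f k. f \<in> S \<Longrightarrow> \<exists>C. \<forall>x. norm x ^ k * cmod (f x) \<le> C"
  shows "schwartz f"
proof -
  have "partials vs f \<in> S" if "set vs \<subseteq> Basis" "f \<in> S" for vs f
    using that
  proof (induction vs arbitrary: f rule: rev_induct)
    case (snoc v vs)
    then show ?case by (simp add: partials_snoc partial)
  qed simp
  then have "\<exists>C. \<forall>x. norm x ^ k * cmod (partials vs f x) \<le> C" if "vs \<in> lists Basis" for k vs
    using bd that assms(1) by (meson in_listsD subsetI)
  then show ?thesis
    using smooth_coinduct[OF assms(1) diff partial]
    by (auto simp: schwartz_def bounded_iff abs_mult)
qed

lemma schwartz_bound:
  assumes "schwartz f"
  shows "\<exists>C. \<forall>x. norm x ^ k * cmod (f x) \<le> C"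
proof -
  have "bounded (range (\<lambda>x. norm x ^ k * cmod (partials [] f x)))"
    using assms unfolding schwartz_def by blast
  then show ?thesis by (auto simp: bounded_iff abs_mult)
qed

lemma schwartz_partial:
  assumes "schwartz f" "v \<in> Basis"
  shows "schwartz (partial v f)"
  unfolding schwartz_def
proof (intro conjI allI ballI)
  fix k and vs :: "'a list" assume "vs \<in> lists Basis"
  then have "vs @ [v] \<in> lists Basis" using assms by auto
  then show "bounded (range (\<lambda>x. norm x ^ k * cmod (partials vs (partial v f) x)))"
    using assms unfolding schwartz_def by (metis partials_snoc)
qed (use assms schwartz_def smooth_partial in blast)

lemma test_function_schwartz:
  assumes "test_function f"
  shows "schwartz f"
proof (rule schwartz_coinduct[of f "Collect test_function"])
  show "f \<in> Collect test_function" using assms by simp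
next
  fix f :: "'a \<Rightarrow> complex" and k
  assume "f \<in> Collect test_function"
  then have f: "test_function f" by simp
  then obtain R where R: "\<And>x. norm x > R \<Longrightarrow> f x = 0" using test_function_iff by metis
  obtain M where "M > 0" and M: "\<And>x. cmod (f x) \<le> M" using test_function_bounded[OF f] by metis
  have "norm x ^ k * cmod (f x) \<le> \<bar>R\<bar> ^ k * M" for x
  proof (cases "norm x > R")
    case False
    then show ?thesis using M[of x] by (intro mult_mono power_mono) auto
  qed (use R \<open>M > 0\<close> in auto)
  then show "\<exists>C. \<forall>x. norm x ^ k * cmod (f x) \<le> C" by blast
qed (auto simp: test_function_partial differentiable_on_def dest: test_function_smooth smooth_imp_differentiable)

text \<open>Restriction to a coordinate subspace, permutation of the coordinates and reflection of some
  of them are all covered by isometries that map basis vectors to basis vectors up to sign.\<close>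

lemma schwartz_compose_isometry:
  fixes L :: "'a::euclidean_space \<Rightarrow> 'b::euclidean_space"
  assumes f: "schwartz f" and L: "linear L" and iso: "\<And>x. norm (L x) = norm x"
    and basis: "\<And>v. v \<in> Basis \<Longrightarrow> L v \<in> Basis \<or> - L v \<in> Basis"
  shows "schwartz (\<lambda>x. f (L x))"
  \<comment> \<open>the factor \<open>c\<close> collects the signs from directions \<open>L v\<close> whose negative is a basis vector\<close>
proof (rule schwartz_coinduct[of _ "{\<lambda>x. c * g (L x) | c g. schwartz g}"])
  show "(\<lambda>x. f (L x)) \<in> {\<lambda>x. c * g (L x) | c g. schwartz g}"
    using f by (auto intro!: exI[of _ 1])
next
  fix h assume "h \<in> {\<lambda>x. c * g (L x) | c g. schwartz g}"
  then obtain c g where h: "h = (\<lambda>x. c * g (L x))" "schwartz g" by blast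
  have sm: "smooth g" using h by (simp add: schwartz_def)
  then have "smooth h" unfolding h by (intro smooth_mult[OF smooth_const smooth_linear[OF L sm]])
  then show "h differentiable_on UNIV"
    by (simp add: differentiable_on_def smooth_imp_differentiable)
  show "partial v h \<in> {\<lambda>x. c * g (L x) | c g. schwartz g}" if v: "v \<in> Basis" for v
  proof -
    have eq: "partial v h = (\<lambda>x. c * partial (L v) g (L x))"
      unfolding h by (simp add: partial_cmult[OF smooth_linear[OF L sm]] partial_linear[OF L sm])
      from basis[OF v] show ?thesis
    proof
      assume "L v \<in> Basis"
      then show ?thesis using eq schwartz_partial[OF h(2)] by blast
    next
      assume b: "- L v \<in> Basis"
      have "partial v h = (\<lambda>x. (- c) * partial (- L v) g (L x))"
        using eq by (simp add: partial_minus_direction[OF sm])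
      then show ?thesis using schwartz_partial[OF h(2) b] by blast
    qed
  qed
  fix k
  obtain C where "\<And>y. norm y ^ k * cmod (g y) \<le> C" using schwartz_bound[OF h(2)] by blast
  from this[of "L x" for x] have "norm x ^ k * cmod (g (L x)) \<le> C" for x by (simp add: iso)
  then have "cmod c * (norm x ^ k * cmod (g (L x))) \<le> cmod c * C" for x
    by (rule mult_left_mono) simp
  then show "\<exists>C. \<forall>x. norm x ^ k * cmod (h x) \<le> C"
    by (auto simp: h norm_mult algebra_simps)
qed

section \<open>Bump functions\<close>

text \<open>The derivatives of \<open>exp (- 1 / x)\<close> are \<open>p (1 / x) exp (- 1 / x)\<close> for these polynomials
  \<open>p\<close>.\<close>

primrec flat_poly :: "nat \<Rightarrow> real poly" where
  "flat_poly 0 = 1"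
| "flat_poly (Suc n) = [:0, 0, 1:] * (flat_poly n - pderiv (flat_poly n))"

definition flat_exp :: "nat \<Rightarrow> real \<Rightarrow> real" where
  "flat_exp n x = (if x > 0 then poly (flat_poly n) (1 / x) * exp (- (1 / x)) else 0)"

lemma poly_times_exp_minus_tendsto_0:
  "((\<lambda>y. poly p y * exp (- y)) \<longlongrightarrow> 0) (at_top :: real filter)"
proof -
  have "((\<lambda>y. y ^ k * poly p y * exp (- y)) \<longlongrightarrow> 0) (at_top :: real filter)" for k
  proof (induction p arbitrary: k)
    case (pCons a p)
    have "((\<lambda>y. a * (y ^ k / exp y)) \<longlongrightarrow> a * 0) (at_top :: real filter)"
      by (intro tendsto_mult tendsto_const tendsto_power_div_exp_0)
    from tendsto_add[OF this pCons.IH[of "Suc k"]] show ?case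
      by (simp add: algebra_simps exp_minus divide_inverse)
  qed simp
  from this[of 0] show ?thesis by simp
qed

lemma flat_exp_has_real_derivative: "(flat_exp n has_real_derivative flat_exp (Suc n) x) (at x)"
proof -
  consider "x > 0" | "x < 0" | "x = 0" by linarith
  then show ?thesis
  proof cases
    case 1
    have "((\<lambda>x. poly (flat_poly n) (1 / x) * exp (- (1 / x))) has_real_derivative flat_exp (Suc n) x) (at x)"
      using 1
      by (auto intro!: derivative_eq_intros DERIV_chain2[OF poly_DERIV]
          simp: flat_exp_def algebra_simps power2_eq_square divide_simps)
    then show ?thesis
      by (rule has_field_derivative_transform_within_open[of _ _ _ "{0<..}"])
        (use 1 in \<open>auto simp: flat_exp_def\<close>)
  next
    case 2
    have "((\<lambda>x. 0) has_real_derivative flat_exp (Suc n) x) (at x)"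
      using 2 by (auto simp: flat_exp_def)
    then show ?thesis
      by (rule has_field_derivative_transform_within_open[of _ _ _ "{..<0}"])
        (use 2 in \<open>auto simp: flat_exp_def\<close>)
  next
    case 3
    have "((\<lambda>h. (flat_exp n h - flat_exp n 0) / (h - 0)) \<longlongrightarrow> 0) (at 0)"
    proof (rule filterlim_split_at)
      have "((\<lambda>h. (flat_exp n h - flat_exp n 0) / (h - 0)) \<longlongrightarrow> 0) (at_left 0) \<longleftrightarrow> ((\<lambda>h::real. 0::real) \<longlongrightarrow> 0) (at_left 0)"
        by (intro tendsto_cong) (auto simp: eventually_at_filter flat_exp_def)
      then show "((\<lambda>h. (flat_exp n h - flat_exp n 0) / (h - 0)) \<longlongrightarrow> 0) (at_left 0)" by simp
    next
      have "((\<lambda>h. poly ([:0, 1:] * flat_poly n) (inverse h) * exp (- inverse h)) \<longlongrightarrow> 0) (at_right 0)"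
        by (rule filterlim_compose[OF poly_times_exp_minus_tendsto_0 filterlim_inverse_at_top_right])
      moreover have "\<forall>\<^sub>F h in at_right 0. poly ([:0, 1:] * flat_poly n) (inverse h) * exp (- inverse h)
          = (flat_exp n h - flat_exp n 0) / (h - 0)"
        by (auto simp: eventually_at_filter flat_exp_def divide_inverse)
      ultimately show "((\<lambda>h. (flat_exp n h - flat_exp n 0) / (h - 0)) \<longlongrightarrow> 0) (at_right 0)"
        by (rule Lim_transform_eventually)
    qed
    then show ?thesis
      using 3 by (simp add: has_field_derivative_iff flat_exp_def)
  qed
qed

lemma smooth_flat_exp:
  "smooth (\<lambda>x. of_real (g x)) \<Longrightarrow> smooth (\<lambda>x. complex_of_real (flat_exp n (g x)))"
  by (rule smooth_compose_real[where F = "\<lambda>n x. complex_of_real (flat_exp n x)"])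
    (auto intro!: has_vector_derivative_of_real flat_exp_has_real_derivative
      simp flip: has_real_derivative_iff_has_vector_derivative)

lemma smooth_norm_diff_square: "smooth (\<lambda>x. complex_of_real ((norm (x - a))\<^sup>2))"
proof -
  have "smooth (\<lambda>x. \<Sum>b\<in>Basis. complex_of_real ((x - a) \<bullet> b) * of_real ((x - a) \<bullet> b))"
    unfolding inner_diff_left of_real_diff
    by (intro smooth_sum smooth_mult smooth_diff smooth_const smooth_of_real_linear finite_Basis
        bounded_linear.linear[OF bounded_linear_inner_left])
  moreover have "(\<Sum>b\<in>Basis. complex_of_real ((x - a) \<bullet> b) * of_real ((x - a) \<bullet> b))
      = of_real ((norm (x - a))\<^sup>2)" for x
    unfolding power2_norm_eq_inner by (subst euclidean_inner) simp
  ultimately show ?thesis by simp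
qed

text \<open>The plateau comes from the quotient \<open>e(s) / (e(s) + e(1 - s))\<close> with \<open>e(s) = exp (- 1 / s)\<close> for
  \<open>s > 0\<close> and \<open>e(s) = 0\<close> otherwise: it is \<open>0\<close> for \<open>s \<le> 0\<close> and \<open>1\<close> for \<open>s \<ge> 1\<close>, and its denominator
  has no zeros.\<close>

lemma bump_function_exists:
  fixes a :: "'a::euclidean_space"
  assumes "0 \<le> r1" "r1 < r2"
  obtains \<rho> where "smooth \<rho>" "\<And>x. dist a x \<le> r1 \<Longrightarrow> \<rho> x = 1" "\<And>x. r2 \<le> dist a x \<Longrightarrow> \<rho> x = 0"
    "\<And>x. cmod (\<rho> x) \<le> 1"
proof -
  \<comment> \<open>a smooth function that is at least \<open>1\<close> on the inner ball and at most \<open>0\<close> off the outer one\<close>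
  define g where "g x = (r2\<^sup>2 - (norm (x - a))\<^sup>2) / (r2\<^sup>2 - r1\<^sup>2)" for x
  define \<rho> where "\<rho> x = complex_of_real (flat_exp 0 (g x))
      * inverse (of_real (flat_exp 0 (g x)) + of_real (flat_exp 0 (1 - g x)))" for x
  have pos: "r2\<^sup>2 - r1\<^sup>2 > 0" using assms by (simp add: power_strict_mono)
  have nonneg: "flat_exp 0 s \<ge> 0" "s > 0 \<Longrightarrow> flat_exp 0 s > 0" "s \<le> 0 \<Longrightarrow> flat_exp 0 s = 0" for s
    by (auto simp: flat_exp_def)
  have den: "flat_exp 0 (g x) + flat_exp 0 (1 - g x) > 0" for x
    using nonneg[of "g x"] nonneg[of "1 - g x"] by (cases "g x > 0") auto
  have sg: "smooth (\<lambda>x. complex_of_real (g x))"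
    using smooth_mult[OF smooth_diff[OF smooth_const[of "of_real (r2\<^sup>2)"] smooth_norm_diff_square[of a]]
        smooth_const[of "of_real (1 / (r2\<^sup>2 - r1\<^sup>2))"]]
    by (simp add: g_def)
  have sg': "smooth (\<lambda>x. complex_of_real (1 - g x))"
    using smooth_diff[OF smooth_const[of 1] sg] by simp
  have "smooth \<rho>"
    unfolding \<rho>_def
  proof (intro smooth_mult smooth_inverse smooth_add smooth_flat_exp sg sg')
    show "complex_of_real (flat_exp 0 (g x)) + of_real (flat_exp 0 (1 - g x)) \<noteq> 0" for x
      using den[of x] by (metis less_irrefl of_real_0 of_real_add of_real_eq_iff)
  qed
  moreover have "\<rho> x = 1" if "dist a x \<le> r1" for x
  proof -
    have "(norm (x - a))\<^sup>2 \<le> r1\<^sup>2" using that by (simp add: dist_norm norm_minus_commute power_mono)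
    then have "1 - g x \<le> 0" using pos by (simp add: g_def)
    then show ?thesis using den[of x] nonneg(3)[of "1 - g x"] by (simp add: \<rho>_def)
  qed
  moreover have "\<rho> x = 0" if "r2 \<le> dist a x" for x
  proof -
    have "r2\<^sup>2 \<le> (norm (x - a))\<^sup>2"
      using that assms by (simp add: dist_norm norm_minus_commute power_mono)
    then have "g x \<le> 0" using pos by (simp add: g_def divide_le_0_iff)
    then show ?thesis using nonneg(3)[of "g x"] by (simp add: \<rho>_def)
  qed
  moreover have "cmod (\<rho> x) \<le> 1" for x
  proof -
    have "\<rho> x = of_real (flat_exp 0 (g x) / (flat_exp 0 (g x) + flat_exp 0 (1 - g x)))"
      by (simp add: \<rho>_def divide_inverse)
    then have "cmod (\<rho> x) = \<bar>flat_exp 0 (g x) / (flat_exp 0 (g x) + flat_exp 0 (1 - g x))\<bar>"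
      by (simp only: norm_of_real)
    also have "\<dots> = flat_exp 0 (g x) / (flat_exp 0 (g x) + flat_exp 0 (1 - g x))"
      using den[of x] nonneg(1)[of "g x"] by simp
    also have "\<dots> \<le> 1"
      using den[of x] nonneg(1)[of "1 - g x"] by simp
    finally show ?thesis .
  qed
  ultimately show ?thesis using that by blast
qed

lemma bump_is_test_function:
  fixes p :: "'a::euclidean_space"
  assumes "smooth \<rho>" "\<And>x. e \<le> dist p x \<Longrightarrow> \<rho> x = 0"
  shows "test_function \<rho>"
proof -
  have "\<rho> x = 0" if "norm x > norm p + e" for x
    by (rule assms(2)) (use that norm_triangle_ineq2[of x p] in \<open>simp add: dist_norm norm_minus_commute\<close>)
  then show ?thesis using assms(1) by (auto simp: test_function_iff)
qed

section \<open>Integrals depending on a parameter\<close>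

lemma integrable_continuous_bounded_support:
  fixes f :: "'a::euclidean_space \<Rightarrow> complex"
  assumes "continuous_on UNIV f" and "\<And>x. norm x > R \<Longrightarrow> f x = 0"
  shows "integrable lborel f"
proof -
  have "integrable lborel (\<lambda>x. indicator (cball 0 R) x *\<^sub>R f x)"
    using assms by (intro borel_integrable_compact) (auto intro: continuous_on_subset)
  moreover have "(\<lambda>x. indicator (cball 0 R) x *\<^sub>R f x) = f"
    using assms(2) by (auto simp: fun_eq_iff indicator_def)
  ultimately show ?thesis by simp
qed

lemma test_function_integrable: "test_function f \<Longrightarrow> integrable lborel f"
  using integrable_continuous_bounded_support smooth_continuous_on test_function_iff by metis

text \<open>The support in \<open>t\<close> is bounded uniformly for \<open>z\<close> near \<open>z0\<close>, so the integral is one over a compact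
  box and the Leibniz rule applies.  The bound is required only near \<open>z0\<close> in order to cover
  translates \<open>G (s v + t)\<close>, whose support moves with \<open>s\<close>.\<close>

lemma has_derivative_integral_parameter:
  fixes H :: "'z::euclidean_space \<times> 't::euclidean_space \<Rightarrow> complex"
  assumes H: "smooth H" and supp: "\<And>z t. z \<in> ball z0 1 \<Longrightarrow> norm t > R \<Longrightarrow> H (z, t) = 0"
  shows "((\<lambda>z. \<integral>t. H (z, t) \<partial>lborel) has_derivative (\<lambda>w. \<integral>t. partial (w, 0) H (z0, t) \<partial>lborel)) (at z0)"
proof -
  obtain c where c: "cball 0 R \<subseteq> cbox (- c) (c :: 't)"
    using bounded_subset_cbox_symmetric[OF bounded_cball] by metis
  have integral_cbox: "(\<integral>t. h t \<partial>lborel) = integral (cbox (- c) c) h"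
    if "continuous_on UNIV h" "\<And>t. norm t > R \<Longrightarrow> h t = 0" for h :: "'t \<Rightarrow> complex"
  proof -
    have "(h has_integral (\<integral>t. h t \<partial>lborel)) UNIV"
      using integrable_continuous_bounded_support[OF that] by (rule has_integral_integral_lborel)
    moreover have "((\<lambda>t. if t \<in> cbox (- c) c then h t else 0) has_integral (\<integral>t. h t \<partial>lborel)) UNIV
        \<longleftrightarrow> (h has_integral (\<integral>t. h t \<partial>lborel)) UNIV"
      by (intro has_integral_cong) (use that(2) c in \<open>auto simp: subset_iff\<close>, meson not_le)
    ultimately have "(h has_integral (\<integral>t. h t \<partial>lborel)) (cbox (- c) c)"
      using has_integral_restrict_UNIV by metis
    then show ?thesis by (simp add: integral_unique)
  qed
  \<comment> \<open>the derivative with respect to \<open>z\<close>, assembled from partial derivatives so that its continuity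
    in the operator norm is evident\<close>
  define H' where "H' z t = (\<Sum>b\<in>Basis. blinfun_scaleR_left (partial (b, 0) H (z, t)) o\<^sub>L blinfun_inner_left b)"
    for z t
  have cont: "continuous_on UNIV (partial w H)" for w
    by (rule smooth_continuous_on[OF smooth_partial_direction[OF H]])
  have H': "blinfun_apply (H' z t) w = partial (w, 0) H (z, t)" for z t w
  proof -
    interpret linear "\<lambda>w. partial w H (z, t)"
      by (rule has_derivative_linear[OF smooth_has_derivative[OF H]])
    have "(w, 0) = (\<Sum>b\<in>Basis. (w \<bullet> b) *\<^sub>R (b, 0 :: 't))"
      by (simp add: prod_eq_iff fst_sum snd_sum euclidean_representation)
    then have "partial (w, 0) H (z, t) = (\<Sum>b\<in>Basis. (w \<bullet> b) *\<^sub>R partial (b, 0) H (z, t))"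
      by (simp only: sum scale)
    then show ?thesis
      by (simp add: H'_def blinfun.sum_left)
  qed
  then have H'_fun: "blinfun_apply (H' z t) = (\<lambda>w. partial (w, 0) H (z, t))" for z t
    by blast
  have contH: "continuous_on UNIV (\<lambda>t. H (z, t))" for z
    by (intro continuous_on_compose2[OF smooth_continuous_on[OF H, of UNIV]] continuous_intros) auto
  have "((\<lambda>z. integral (cbox (- c) c) (\<lambda>t. H (z, t))) has_derivative integral (cbox (- c) c) (H' z0))
      (at z0 within ball z0 1)"
  proof (rule leibniz_rule)
    fix z :: 'z and t :: 't
    have "((\<lambda>z. (z, t)) has_derivative (\<lambda>w. (w, 0))) (at z)"
      by (auto intro!: derivative_eq_intros)
    from has_derivative_compose[OF this smooth_has_derivative[OF H]]
    show "((\<lambda>z. H (z, t)) has_derivative blinfun_apply (H' z t)) (at z within ball z0 1)"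
      by (simp add: has_derivative_at_withinI H'_fun)
  next
    show "(\<lambda>t. H (z, t)) integrable_on cbox (- c) c" for z
      by (rule integrable_continuous) (rule continuous_on_subset[OF contH], simp)
    show "continuous_on (ball z0 1 \<times> cbox (- c) c) (\<lambda>(z, t). H' z t)"
      unfolding H'_def case_prod_beta
      by (intro continuous_intros continuous_on_compose2[OF cont]) auto
  qed auto
  then have D: "((\<lambda>z. integral (cbox (- c) c) (\<lambda>t. H (z, t))) has_derivative integral (cbox (- c) c) (H' z0))
      (at z0)"
    by (simp add: at_within_open[OF _ open_ball])
  have "integral (cbox (- c) c) (H' z0) w = (\<integral>t. partial (w, 0) H (z0, t) \<partial>lborel)" for w
  proof -
    have "continuous_on (cbox (- c) c) (H' z0)"
      unfolding H'_def by (intro continuous_intros continuous_on_compose2[OF cont]) auto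
    then have "integral (cbox (- c) c) (H' z0) w = integral (cbox (- c) c) (\<lambda>t. partial (w, 0) H (z0, t))"
      by (simp add: blinfun_apply_integral integrable_continuous H')
    moreover have "partial (w, 0) H (z0, t) = 0" if "norm t > R" for t
    proof (rule partial_zero_locally)
      show "open (ball z0 1 \<times> {t. norm t > R})"
        by (intro open_Times open_ball open_Collect_less continuous_intros)
    qed (use that supp in auto)
    moreover have "continuous_on UNIV (\<lambda>t. partial (w, 0) H (z0, t))"
      by (intro continuous_on_compose2[OF cont] continuous_intros) auto
    ultimately show ?thesis using integral_cbox by metis
  qed
  then have D: "((\<lambda>z. integral (cbox (- c) c) (\<lambda>t. H (z, t))) has_derivative
      (\<lambda>w. \<integral>t. partial (w, 0) H (z0, t) \<partial>lborel)) (at z0)"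
    using D by presburger
  show ?thesis
    by (rule has_derivative_transform_within_open[OF D open_ball[of z0 1]])
      (use integral_cbox[OF contH] supp in auto)
qed

lemma lborel_integral_translate:
  fixes f :: "'a::euclidean_space \<Rightarrow> complex"
  assumes "f \<in> borel_measurable borel"
  shows "(\<integral>x. f (c + x) \<partial>lborel) = (\<integral>x. f x \<partial>lborel)"
proof -
  have "(\<integral>x. f x \<partial>lborel) = (\<integral>x. f x \<partial>distr lborel borel ((+) c))"
    by (simp add: lborel_distr_plus)
  also have "\<dots> = (\<integral>x. f (c + x) \<partial>lborel)"
    using assms by (intro integral_distr) auto
  finally show ?thesis ..
qed

lemma smooth_borel_measurable: "smooth f \<Longrightarrow> f \<in> borel_measurable borel"
  by (intro borel_measurable_continuous_onI smooth_continuous_on)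

text \<open>By translation invariance, the integral of \<open>G (s v + t)\<close> over \<open>t\<close> does not depend on \<open>s\<close>; the claim
  is its derivative at \<open>s = 0\<close>.\<close>

lemma integral_partial_eq_0:
  fixes G :: "'a::euclidean_space \<Rightarrow> complex"
  assumes G: "test_function G"
  shows "(\<integral>t. partial v G t \<partial>lborel) = 0"
proof -
  obtain R where R: "\<And>x. norm x > R \<Longrightarrow> G x = 0" using G test_function_iff by metis
  define L where "L = (\<lambda>(s, t). s *\<^sub>R v + t :: 'a)"
  have L: "linear L"
    by (auto intro!: linearI simp: L_def algebra_simps)
  have sG: "smooth G" using G by (rule test_function_smooth)
  have supp: "G (L (s, t)) = 0" if "s \<in> ball 0 1" "norm t > R + norm v" for s t
  proof (rule R)
    have "\<bar>s\<bar> * norm v \<le> 1 * norm v" using that by (intro mult_right_mono) auto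
    then have "norm (s *\<^sub>R v) \<le> norm v" by simp
    moreover have "norm t \<le> norm (s *\<^sub>R v + t) + norm (s *\<^sub>R v)"
      by (metis add.commute norm_add_leD norm_triangle_sub add_diff_cancel_left' order_refl)
    ultimately show "R < norm (L (s, t))" using that by (simp add: L_def)
  qed
  have "((\<lambda>s. \<integral>t. G (L (s, t)) \<partial>lborel) has_derivative (\<lambda>w. \<integral>t. partial (w, 0) (\<lambda>z. G (L z)) (0, t) \<partial>lborel))
      (at 0)"
    by (rule has_derivative_integral_parameter[where R = "R + norm v"])
      (auto intro: smooth_linear[OF L sG] supp)
  moreover have "(\<integral>t. G (L (s, t)) \<partial>lborel) = (\<integral>t. G t \<partial>lborel)" for s
    unfolding L_def prod.case
    by (rule lborel_integral_translate) (rule smooth_borel_measurable[OF sG])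
  ultimately have "(\<lambda>w. \<integral>t. partial (w, 0) (\<lambda>z. G (L z)) (0, t) \<partial>lborel) = (\<lambda>_. 0)"
    using has_derivative_unique has_derivative_const by (metis (no_types, lifting) ext)
  from fun_cong[OF this, of 1] show ?thesis
    by (simp add: partial_linear[OF L sG]) (simp add: L_def)
qed

section \<open>The partial Fourier transform of test functions\<close>

abbreviation character :: "real \<Rightarrow> complex" where
  "character s \<equiv> exp (- 2 * of_real pi * \<i> * of_real s)"

definition partial_fourier :: "('b::euclidean_space \<times> 'a::euclidean_space \<Rightarrow> complex) \<Rightarrow> 'b \<times> 'a \<Rightarrow> complex" where
  "partial_fourier F = (\<lambda>(x, \<omega>). fourier (\<lambda>t. F (x, t)) \<omega>)"

lemma norm_character: "cmod (character s) = 1"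
  using norm_exp_i_times[of "- 2 * pi * s"] by (simp add: algebra_simps)

lemma character_has_vector_derivative:
  "(character has_vector_derivative (- 2 * of_real pi * \<i>) * character s) (at s)"
proof (rule has_vector_derivative_real_field)
  show "((\<lambda>z. exp (- 2 * of_real pi * \<i> * z)) has_field_derivative
      (- 2 * of_real pi * \<i>) * character s) (at (of_real s))"
    by (auto intro!: derivative_eq_intros)
qed

lemma smooth_character_compose:
  assumes "smooth (\<lambda>x. of_real (g x))"
  shows "smooth (\<lambda>x. character (g x))"
proof -
  define F where "F n s = (- 2 * of_real pi * \<i>) ^ n * character s" for n s
  have "(F n has_vector_derivative F (Suc n) s) (at s)" for n s
    unfolding F_def
    using has_vector_derivative_mult_right[OF character_has_vector_derivative, of "(- 2 * of_real pi * \<i>) ^ n" s]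
    by (simp add: algebra_simps)
  then have "smooth (\<lambda>x. F 0 (g x))" using assms by (rule smooth_compose_real)
  then show ?thesis by (simp add: F_def)
qed

lemma smooth_inner:
  fixes K L :: "'b::euclidean_space \<Rightarrow> 'a::euclidean_space"
  assumes "linear K" "linear L"
  shows "smooth (\<lambda>x. complex_of_real (K x \<bullet> L x))"
proof -
  have lin: "linear (\<lambda>x. M x \<bullet> b)" if "linear M" for M :: "'b \<Rightarrow> 'a" and b
    using linear_compose[OF that bounded_linear.linear[OF bounded_linear_inner_left, of b]]
    by (simp add: o_def)
  have "smooth (\<lambda>x. \<Sum>b\<in>Basis. complex_of_real (K x \<bullet> b) * of_real (L x \<bullet> b))"
    by (intro smooth_sum smooth_mult smooth_of_real_linear lin assms finite_Basis)
  then show ?thesis by (subst euclidean_inner) simp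
qed

lemma smooth_modulation: "smooth f \<Longrightarrow> smooth (\<lambda>t. f t * character (\<omega> \<bullet> t))"
  by (intro smooth_mult smooth_character_compose smooth_of_real_linear
      bounded_linear.linear[OF bounded_linear_inner_right])

lemma test_function_slice:
  fixes F :: "'b::euclidean_space \<times> 'a::euclidean_space \<Rightarrow> complex"
  assumes "test_function F"
  shows "test_function (\<lambda>t. F (x, t))"
proof -
  have "linear (\<lambda>t::'a. (0 :: 'b, t))" by (auto intro!: linearI)
  from smooth_affine[OF this, of F "(x, 0)"] have "smooth (\<lambda>t. F (x, t))"
    using test_function_smooth[OF assms] by simp
  moreover obtain R where R: "\<And>z. norm z > R \<Longrightarrow> F z = 0"
    using assms test_function_iff by metis
  have "F (x, t) = 0" if "norm t > R" for t
    by (rule R) (use that norm_snd_le[of t x] in linarith)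
  ultimately show ?thesis by (auto simp: test_function_iff)
qed

text \<open>Differentiating in \<open>x\<close> differentiates \<open>F\<close>, and differentiating in the frequency multiplies \<open>F\<close>
  by a linear function of \<open>t\<close>: partial Fourier transforms of test functions are closed under
  differentiation.\<close>

lemma partial_fourier_has_derivative:
  fixes F :: "'b::euclidean_space \<times> 'a::euclidean_space \<Rightarrow> complex"
  assumes F: "test_function F"
  shows "(partial_fourier F has_derivative (\<lambda>(u, w).
      partial_fourier (\<lambda>(x, t). partial (u, 0) F (x, t) + of_real (w \<bullet> t) * (- 2 * of_real pi * \<i>) * F (x, t)) z)) (at z)"
proof -
  define H where "H = (\<lambda>(z, t). F (fst z, t) * character (snd z \<bullet> t))"
  define P where "P = (\<lambda>(z :: 'b \<times> 'a, t :: 'a). (fst z, t))"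
  have P: "linear P" by (auto intro!: linearI simp: P_def)
  have sF: "smooth F" using F by (rule test_function_smooth)
  have lin: "linear (\<lambda>y. snd (fst y))" "linear (\<lambda>y::('b \<times> 'a) \<times> 'a. snd y)"
    by (auto intro!: linearI)
  have H_eq: "H = (\<lambda>y. F (P y) * character (snd (fst y) \<bullet> snd y))"
    by (auto simp: H_def P_def)
  have sH: "smooth H"
    unfolding H_eq
    by (rule smooth_mult[OF smooth_linear[OF P sF] smooth_character_compose[OF smooth_inner[OF lin]]])
  obtain R where R: "\<And>y. norm y > R \<Longrightarrow> F y = 0"
    using F test_function_iff by metis
  have supp: "H (z, t) = 0" if "norm t > R" for z t
    using R[of "(fst z, t)"] that norm_snd_le[of t "fst z"] by (simp add: H_def)
  have pdH: "partial ((u, w), 0) H (z, t) = (partial (u, 0) F (fst z, t)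
      + of_real (w \<bullet> t) * (- 2 * of_real pi * \<i>) * F (fst z, t)) * character (snd z \<bullet> t)" for u w t
  proof -
    have "((\<lambda>y. snd (fst y) \<bullet> snd y) has_derivative
        (\<lambda>v. snd (fst v) \<bullet> t + snd z \<bullet> snd v)) (at (z, t))"
      by (auto intro!: derivative_eq_intros)
    from has_derivative_compose[OF this character_has_vector_derivative[unfolded has_vector_derivative_def]]
    have D1: "((\<lambda>y. character (snd (fst y) \<bullet> snd y)) has_derivative
        (\<lambda>v. (snd (fst v) \<bullet> t + snd z \<bullet> snd v) *\<^sub>R ((- 2 * of_real pi * \<i>) * character (snd z \<bullet> t)))) (at (z, t))"
      by simp
    have "((\<lambda>y. F (P y)) has_derivative (\<lambda>v. partial (P v) F (P (z, t)))) (at (z, t))"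
      by (intro has_derivative_compose[OF linear_imp_has_derivative[OF P] smooth_has_derivative[OF sF]])
    from has_derivative_mult[OF this D1] have "(H has_derivative
        (\<lambda>v. F (P (z, t)) * ((snd (fst v) \<bullet> t + snd z \<bullet> snd v) *\<^sub>R ((- 2 * of_real pi * \<i>) * character (snd z \<bullet> t)))
          + partial (P v) F (P (z, t)) * character (snd z \<bullet> t))) (at (z, t))"
      by (simp add: H_eq)
    from frechet_derivative_at[OF this, symmetric] show ?thesis
      unfolding partial_def[of _ H]
      by (simp add: P_def scaleR_conv_of_real algebra_simps)
  qed
  have "((\<lambda>z. \<integral>t. H (z, t) \<partial>lborel) has_derivative (\<lambda>w. \<integral>t. partial (w, 0) H (z, t) \<partial>lborel)) (at z)"
    by (rule has_derivative_integral_parameter[OF sH supp])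
  moreover have "(\<lambda>z. \<integral>t. H (z, t) \<partial>lborel) = partial_fourier F"
    by (auto simp: H_def partial_fourier_def fourier_def)
  moreover have "(\<lambda>w. \<integral>t. partial (w, 0) H (z, t) \<partial>lborel) = (\<lambda>(u, w).
      partial_fourier (\<lambda>(x, t). partial (u, 0) F (x, t) + of_real (w \<bullet> t) * (- 2 * of_real pi * \<i>) * F (x, t)) z)"
    by (auto simp: fun_eq_iff pdH partial_fourier_def fourier_def case_prod_beta)
  ultimately show ?thesis by simp
qed

lemma partial_modulation:
  assumes "smooth f"
  shows "partial v (\<lambda>t. f t * character (\<omega> \<bullet> t))
    = (\<lambda>t. partial v f t * character (\<omega> \<bullet> t) + (- 2 * of_real pi * \<i>) * of_real (\<omega> \<bullet> v) * (f t * character (\<omega> \<bullet> t)))"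
proof -
  have "((\<lambda>t. \<omega> \<bullet> t) has_derivative (\<lambda>v. \<omega> \<bullet> v)) (at t)" for t
    by (auto intro!: derivative_eq_intros)
  from has_derivative_mult[OF smooth_has_derivative[OF assms]
      has_derivative_compose[OF this character_has_vector_derivative[unfolded has_vector_derivative_def]]]
  show ?thesis
    by (subst partial_eqI, assumption) (simp add: scaleR_conv_of_real algebra_simps)
qed

text \<open>Integration by parts: the derivative of \<open>f t * character (\<omega> \<bullet> t)\<close> has integral zero.\<close>

lemma fourier_partial:
  assumes f: "test_function f"
  shows "fourier (partial v f) \<omega> = 2 * of_real pi * \<i> * of_real (\<omega> \<bullet> v) * fourier f \<omega>"
proof -
  let ?e = "\<lambda>t. character (\<omega> \<bullet> t)"
  have sf: "smooth f" using f by (rule test_function_smooth)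
  have tf: "test_function (\<lambda>t. f t * ?e t)" if "test_function f" for f
    using smooth_modulation[of "\<lambda>_. 1" \<omega>] that test_function_mult by (simp add: smooth_const)
  have "0 = (\<integral>t. partial v (\<lambda>t. f t * ?e t) t \<partial>lborel)"
    using integral_partial_eq_0[OF tf[OF f]] by simp
  also have "\<dots> = (\<integral>t. partial v f t * ?e t + (- 2 * of_real pi * \<i>) * of_real (\<omega> \<bullet> v) * (f t * ?e t) \<partial>lborel)"
    unfolding partial_modulation[OF sf] ..
  also have "\<dots> = (\<integral>t. partial v f t * ?e t \<partial>lborel)
      + (\<integral>t. (- 2 * of_real pi * \<i>) * of_real (\<omega> \<bullet> v) * (f t * ?e t) \<partial>lborel)"
    by (intro Bochner_Integration.integral_add integrable_mult_right test_function_integrable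
        tf f test_function_partial)
  also have "\<dots> = fourier (partial v f) \<omega> + (- 2 * of_real pi * \<i>) * of_real (\<omega> \<bullet> v) * fourier f \<omega>"
    by (simp only: integral_mult_right_zero fourier_def)
  finally show ?thesis by (simp add: algebra_simps)
qed

lemma partial_fourier_bounded:
  fixes F :: "'b::euclidean_space \<times> 'a::euclidean_space \<Rightarrow> complex"
  assumes F: "test_function F"
  shows "\<exists>C. \<forall>z. cmod (partial_fourier F z) \<le> C"
proof -
  obtain R where R: "\<And>y. norm y > R \<Longrightarrow> F y = 0" using F test_function_iff by metis
  obtain M where M: "\<And>y. cmod (F y) \<le> M" using test_function_bounded[OF F] by metis
  define C where "C = (\<integral>t. M * indicator (cball 0 R) (t :: 'a) \<partial>lborel)"
  have "cmod (partial_fourier F (x, \<omega>)) \<le> C" for x \<omega>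
    unfolding partial_fourier_def fourier_def prod.case C_def
  proof (rule Bochner_Integration.integral_norm_bound_integral)
    show "integrable lborel (\<lambda>t. F (x, t) * character (\<omega> \<bullet> t))"
      using smooth_modulation[of "\<lambda>_. 1" \<omega>] test_function_mult[OF test_function_slice[OF F]]
      by (intro test_function_integrable) (simp add: smooth_const)
    show "integrable lborel (\<lambda>t. M * indicator (cball 0 R) (t :: 'a))"
      using emeasure_bounded_finite[OF bounded_cball, of 0 R]
      by (intro integrable_mult_right integrable_real_indicator) auto
    show "cmod (F (x, t) * character (\<omega> \<bullet> t)) \<le> M * indicator (cball 0 R) t" for t
      using M[of "(x, t)"] R[of "(x, t)"] norm_snd_le[of t x]
      by (auto simp: norm_mult norm_character indicator_def simp del: mult_minus_left)
  qed
  then show ?thesis by auto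
qed

text \<open>Each factor \<open>norm z\<close> is dominated by \<open>norm x\<close> and the coordinates \<open>\<bar>\<omega> \<bullet> b\<bar>\<close>.  The former is
  bounded on the support of \<open>F\<close>, and the latter turn into derivatives of \<open>F\<close> in the directions
  \<open>(0, b)\<close>.\<close>

lemma partial_fourier_rapid_decay:
  fixes F :: "'b::euclidean_space \<times> 'a::euclidean_space \<Rightarrow> complex"
  shows "test_function F \<Longrightarrow> \<exists>C. \<forall>z. norm z ^ k * cmod (partial_fourier F z) \<le> C"
proof (induction k arbitrary: F)
  case 0
  then show ?case using partial_fourier_bounded by simp
next
  case (Suc k)
  obtain R where R: "\<And>y. norm y > R \<Longrightarrow> F y = 0" using Suc.prems test_function_iff by metis
  let ?D = "\<lambda>b. partial (0, b) F"
  obtain C where C: "\<And>z. norm z ^ k * cmod (partial_fourier F z) \<le> C"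
    using Suc.IH[OF Suc.prems] by blast
  have "\<forall>b. \<exists>C. \<forall>z. norm z ^ k * cmod (partial_fourier (?D b) z) \<le> C"
    using Suc.IH[OF test_function_partial[OF Suc.prems]] by blast
  then obtain D where D: "\<And>b z. norm z ^ k * cmod (partial_fourier (?D b) z) \<le> D b"
    by metis
  have "norm z ^ Suc k * cmod (partial_fourier F z) \<le> \<bar>R\<bar> * C + (\<Sum>b\<in>Basis. D b)" for z
  proof -
    obtain x \<omega> where z: "z = (x, \<omega>)" by force
    let ?p = "cmod (partial_fourier F z)"
    have freq: "\<bar>\<omega> \<bullet> b\<bar> * ?p \<le> cmod (partial_fourier (?D b) z)" for b
    proof -
      have "linear (\<lambda>t::'a. (0 :: 'b, t))" by (auto intro!: linearI)
      from partial_affine[OF this, of 0 F b "(x, 0)"]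
      have "partial b (\<lambda>t. F (x, t)) = (\<lambda>t. ?D b (x, t))"
        using test_function_smooth[OF Suc.prems] by (simp add: smooth_imp_differentiable)
      then have "partial_fourier (?D b) z = 2 * of_real pi * \<i> * of_real (\<omega> \<bullet> b) * partial_fourier F z"
        using fourier_partial[OF test_function_slice[OF Suc.prems], of b x \<omega>]
        by (simp add: partial_fourier_def z)
      then have "cmod (partial_fourier (?D b) z) = (2 * pi) * (\<bar>\<omega> \<bullet> b\<bar> * ?p)"
        by (simp add: norm_mult)
      moreover have "1 * (\<bar>\<omega> \<bullet> b\<bar> * ?p) \<le> (2 * pi) * (\<bar>\<omega> \<bullet> b\<bar> * ?p)"
        using pi_gt3 by (intro mult_right_mono) auto
      ultimately show ?thesis by simp
    qed
    have space: "norm x * ?p \<le> \<bar>R\<bar> * ?p"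
    proof (cases "norm x > R")
      case True
      have "F (x, t) = 0" for t by (rule R) (use True norm_fst_le[of x t] in linarith)
      then show ?thesis by (simp add: z partial_fourier_def fourier_def)
    qed (auto intro!: mult_right_mono)
    have "norm z \<le> norm x + (\<Sum>b\<in>Basis. \<bar>\<omega> \<bullet> b\<bar>)"
      unfolding z using norm_Pair_le[of x \<omega>] norm_le_l1[of \<omega>] by linarith
    then have "norm z * ?p \<le> (norm x + (\<Sum>b\<in>Basis. \<bar>\<omega> \<bullet> b\<bar>)) * ?p"
      by (rule mult_right_mono) simp
    also have "\<dots> = norm x * ?p + (\<Sum>b\<in>Basis. \<bar>\<omega> \<bullet> b\<bar> * ?p)"
      by (simp add: distrib_right sum_distrib_right)
    also have "\<dots> \<le> \<bar>R\<bar> * ?p + (\<Sum>b\<in>Basis. cmod (partial_fourier (?D b) z))"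
      by (intro add_mono sum_mono space freq)
    finally have "norm z ^ k * (norm z * ?p)
        \<le> norm z ^ k * (\<bar>R\<bar> * ?p + (\<Sum>b\<in>Basis. cmod (partial_fourier (?D b) z)))"
      by (rule mult_left_mono) simp
    also have "\<dots> = \<bar>R\<bar> * (norm z ^ k * ?p) + (\<Sum>b\<in>Basis. norm z ^ k * cmod (partial_fourier (?D b) z))"
      by (simp add: distrib_left sum_distrib_left mult.left_commute)
    also have "\<dots> \<le> \<bar>R\<bar> * C + (\<Sum>b\<in>Basis. D b)"
      by (intro add_mono sum_mono D mult_left_mono C) simp
    finally show ?thesis by (simp add: algebra_simps)
  qed
  then show ?case by blast
qed

lemma partial_fourier_schwartz:
  fixes F :: "'b::euclidean_space \<times> 'a::euclidean_space \<Rightarrow> complex"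
  assumes F: "test_function F"
  shows "schwartz (partial_fourier F)"
proof (rule schwartz_coinduct[of _ "partial_fourier ` Collect test_function"])
  fix \<Phi> :: "'b \<times> 'a \<Rightarrow> complex"
  assume "\<Phi> \<in> partial_fourier ` Collect test_function"
  then obtain G where G: "test_function G" and \<Phi>: "\<Phi> = partial_fourier G" by blast
  show "\<exists>C. \<forall>z. norm z ^ k * cmod (\<Phi> z) \<le> C" for k
    unfolding \<Phi> by (rule partial_fourier_rapid_decay[OF G])
  show "\<Phi> differentiable_on UNIV"
    using partial_fourier_has_derivative[OF G] unfolding \<Phi> differentiable_on_def differentiable_def by blast
  fix v :: "'b \<times> 'a"
  obtain u w where v: "v = (u, w)" by force
  let ?G = "\<lambda>(x, t). partial (u, 0) G (x, t) + of_real (w \<bullet> t) * (- 2 * of_real pi * \<i>) * G (x, t)"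
  have "linear (\<lambda>y::'b \<times> 'a. w \<bullet> snd y)" by (auto intro!: linearI simp: inner_simps)
  from smooth_of_real_linear[OF this]
  have "test_function (\<lambda>y. partial (u, 0) G y + (of_real (w \<bullet> snd y) * (- 2 * of_real pi * \<i>)) * G y)"
    by (intro test_function_add test_function_partial test_function_mult' G smooth_mult smooth_const)
  moreover have "(\<lambda>y. partial (u, 0) G y + (of_real (w \<bullet> snd y) * (- 2 * of_real pi * \<i>)) * G y) = ?G"
    by auto
  ultimately have "test_function ?G" by simp
  moreover have "partial v \<Phi> = partial_fourier ?G"
    unfolding \<Phi> v by (subst partial_eqI, rule partial_fourier_has_derivative[OF G]) simp
  ultimately show "partial v \<Phi> \<in> partial_fourier ` Collect test_function" by blast
qed (use F in blast)

lemma test_function_tensor: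
  fixes f :: "'a::euclidean_space \<Rightarrow> complex" and g :: "'b::euclidean_space \<Rightarrow> complex"
  assumes f: "test_function f" and g: "test_function g"
  shows "test_function (\<lambda>(x, y). f x * g y)"
proof -
  have lin: "linear (\<lambda>y. fst y)" "linear (\<lambda>y. snd y)" by (auto intro!: linearI)
  have "smooth (\<lambda>z. f (fst z) * g (snd z))"
    by (rule smooth_mult[OF smooth_linear[OF lin(1)] smooth_linear[OF lin(2)]])
      (use f g in \<open>auto simp: test_function_smooth\<close>)
  moreover obtain R S where R: "\<And>x. norm x > R \<Longrightarrow> f x = 0" and S: "\<And>x. norm x > S \<Longrightarrow> g x = 0"
    using f g test_function_iff by metis
  have "f (fst z) * g (snd z) = 0" if "norm z > R + S" for z
    using that norm_Pair_le[of "fst z" "snd z"] R[of "fst z"] S[of "snd z"]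
    by (cases "norm (fst z) > R") auto
  ultimately have "test_function (\<lambda>z. f (fst z) * g (snd z))"
    unfolding test_function_iff by blast
  then show ?thesis by (simp add: case_prod_beta')
qed

lemma test_function_linear_iso:
  fixes L :: "'a::euclidean_space \<Rightarrow> 'b::euclidean_space"
  assumes f: "test_function f" and L: "linear L" and bound: "\<And>x. norm x \<le> K * norm (L x)"
  shows "test_function (\<lambda>x. f (L x))"
proof -
  obtain R where R: "\<And>x. norm x > R \<Longrightarrow> f x = 0" using f test_function_iff by metis
  have "f (L x) = 0" if "norm x > \<bar>K\<bar> * \<bar>R\<bar>" for x
  proof (rule R, rule ccontr)
    assume "\<not> R < norm (L x)"
    then have "K * norm (L x) \<le> \<bar>K\<bar> * \<bar>R\<bar>" by (intro mult_mono) auto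
    then show False using that bound[of x] by linarith
  qed
  then show ?thesis
    using smooth_linear[OF L test_function_smooth[OF f]] by (auto simp: test_function_iff)
qed

text \<open>The Fourier transform of \<open>f\<close> is the restriction to \<open>x = 0\<close> of the partial Fourier transform of
  \<open>\<rho> x * f t\<close>, where \<open>\<rho>\<close> is a bump function with \<open>\<rho> 0 = 1\<close>.\<close>

lemma fourier_schwartz:
  fixes f :: "'a::euclidean_space \<Rightarrow> complex"
  assumes f: "test_function f"
  shows "schwartz (fourier f)"
proof -
  obtain \<rho> :: "'a \<Rightarrow> complex" where \<rho>: "smooth \<rho>" "\<And>x. dist 0 x \<le> 1 \<Longrightarrow> \<rho> x = 1" "\<And>x. 2 \<le> dist 0 x \<Longrightarrow> \<rho> x = 0"
    using bump_function_exists[of 1 2 0] by (metis one_less_numeral_iff semiring_norm(76) zero_le_one)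
  have "\<forall>x. norm x > 2 \<longrightarrow> \<rho> x = 0" using \<rho>(3) by simp
  then have "test_function \<rho>" using \<rho>(1) test_function_iff by blast
  from schwartz_compose_isometry[OF partial_fourier_schwartz[OF test_function_tensor[OF this f]],
      of "\<lambda>\<omega>::'a. (0 :: 'a, \<omega>)"]
  show ?thesis
    by (simp add: partial_fourier_def \<rho>(2) norm_Pair Basis_prod_def linearI)
qed

lemma inv_fourier_schwartz:
  assumes "test_function f"
  shows "schwartz (inv_fourier f)"
  using schwartz_compose_isometry[OF fourier_schwartz[OF assms], of uminus]
  by (simp add: inv_fourier_def[abs_def] linear_uminus)

section \<open>Fourier inversion\<close>

lemma
  fixes f :: "'a::euclidean_space \<Rightarrow> real \<Rightarrow> complex"
  assumes f: "\<And>b. b \<in> Basis \<Longrightarrow> integrable lborel (f b)"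
  shows integrable_lborel_prod: "integrable lborel (\<lambda>x. \<Prod>b\<in>Basis. f b (x \<bullet> b))"
    and integral_lborel_prod: "(\<integral>x. (\<Prod>b\<in>Basis. f b (x \<bullet> b)) \<partial>lborel) = (\<Prod>b\<in>Basis. \<integral>s. f b s \<partial>lborel)"
proof -
  interpret product_sigma_finite "\<lambda>_::'a. lborel :: real measure" by standard
  let ?T = "\<lambda>g::'a \<Rightarrow> real. \<Sum>b\<in>Basis. g b *\<^sub>R b"
  have T: "?T \<in> measurable (Pi\<^sub>M Basis (\<lambda>_. lborel)) borel" by measurable
  have [measurable]: "f b \<in> borel_measurable borel" if "b \<in> Basis" for b
    using f[OF that] by simp
  have m: "(\<lambda>x. \<Prod>b\<in>Basis. f b (x \<bullet> b)) \<in> borel_measurable borel"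
    by measurable
  have comp: "(\<Prod>b\<in>Basis. f b (?T g \<bullet> b)) = (\<Prod>b\<in>Basis. f b (g b))" for g
    by (intro prod.cong) (auto simp: inner_sum_left_Basis)
  have "integrable (Pi\<^sub>M Basis (\<lambda>_. lborel)) (\<lambda>g. \<Prod>b\<in>Basis. f b (g b))"
    by (rule product_integrable_prod) (use f in auto)
  then show "integrable lborel (\<lambda>x. \<Prod>b\<in>Basis. f b (x \<bullet> b))"
    by (subst lborel_eq) (simp add: integrable_distr_eq[OF T m] comp)
  have "(\<integral>x. (\<Prod>b\<in>Basis. f b (x \<bullet> b)) \<partial>lborel) = (\<integral>g. (\<Prod>b\<in>Basis. f b (g b)) \<partial>Pi\<^sub>M Basis (\<lambda>_. lborel))"
    by (subst lborel_eq) (simp add: integral_distr[OF T m] comp)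
  also have "\<dots> = (\<Prod>b\<in>Basis. \<integral>s. f b s \<partial>lborel)"
    by (rule product_integral_prod) (use f in auto)
  finally show "(\<integral>x. (\<Prod>b\<in>Basis. f b (x \<bullet> b)) \<partial>lborel) = (\<Prod>b\<in>Basis. \<integral>s. f b s \<partial>lborel)" .
qed

definition gaussian :: "'a::euclidean_space \<Rightarrow> complex" where
  "gaussian x = of_real (exp (- (norm x)\<^sup>2 / 2))"

lemma gaussian_prod: "gaussian x = (\<Prod>b\<in>Basis. complex_of_real (exp (- (x \<bullet> b)\<^sup>2 / 2)))"
proof -
  have "- (norm x)\<^sup>2 / 2 = (\<Sum>b\<in>Basis. - (x \<bullet> b)\<^sup>2 / 2)"
    unfolding power2_norm_eq_inner by (subst euclidean_inner)
      (simp add: power2_eq_square sum_negf sum_divide_distrib)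
  then show ?thesis by (simp add: gaussian_def exp_sum)
qed

lemma
  shows integrable_exp_square_1: "integrable lborel (\<lambda>s. complex_of_real (exp (- s\<^sup>2 / 2)) * character (y * s))" (is ?I)
    and fourier_exp_square_1: "(\<integral>s. complex_of_real (exp (- s\<^sup>2 / 2)) * character (y * s) \<partial>lborel)
      = of_real (sqrt (2 * pi)) * of_real (exp (- (2 * pi * y)\<^sup>2 / 2))" (is ?E)
proof -
  have dens: "exp (- s\<^sup>2 / 2) = sqrt (2 * pi) * std_normal_density s" for s :: real
    by (simp add: std_normal_density_def)
  have m: "(\<lambda>s. character (y * s)) \<in> borel_measurable borel"
    by (intro borel_measurable_continuous_onI continuous_intros)
  have "integrable lborel (\<lambda>s. std_normal_density s)"
    using integrable_std_normal_moment_abs[of 0] by simp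
  then have "integrable lborel (\<lambda>s::real. exp (- s\<^sup>2 / 2))"
    unfolding dens by simp
  then show ?I
    by (rule Bochner_Integration.integrable_bound)
      (use m in \<open>auto simp: norm_mult norm_character simp del: mult_minus_left\<close>)
  have iexp: "iexp ((- 2 * pi * y) * s) = character (y * s)" for s
    by (simp add: algebra_simps)
  have "complex_of_real (exp (- (2 * pi * y)\<^sup>2 / 2)) = char std_normal_distribution (- 2 * pi * y)"
    by (simp add: char_std_normal_distribution)
  also have "\<dots> = (\<integral>s. character (y * s) \<partial>std_normal_distribution)"
    unfolding char_def iexp ..
  also have "\<dots> = (\<integral>s. std_normal_density s *\<^sub>R character (y * s) \<partial>lborel)"
    by (subst integral_density) (use m in auto)
  finally have "of_real (sqrt (2 * pi)) * complex_of_real (exp (- (2 * pi * y)\<^sup>2 / 2))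
      = (\<integral>s. of_real (sqrt (2 * pi)) * (std_normal_density s *\<^sub>R character (y * s)) \<partial>lborel)"
    by (simp only: integral_mult_right_zero)
  also have "\<dots> = (\<integral>s. complex_of_real (exp (- s\<^sup>2 / 2)) * character (y * s) \<partial>lborel)"
    unfolding dens by (simp add: scaleR_conv_of_real mult.assoc)
  finally show ?E ..
qed

lemma
  fixes y :: "'a::euclidean_space"
  shows integrable_gaussian_character: "integrable lborel (\<lambda>x. gaussian x * character (y \<bullet> x))" (is ?I)
    and fourier_gaussian: "(\<integral>x. gaussian x * character (y \<bullet> x) \<partial>lborel)
      = of_real (sqrt (2 * pi) ^ DIM('a)) * gaussian ((2 * pi) *\<^sub>R y)" (is ?E)
proof -
  let ?f = "\<lambda>b s. complex_of_real (exp (- s\<^sup>2 / 2)) * character ((y \<bullet> b) * s)"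
  have eq: "gaussian x * character (y \<bullet> x) = (\<Prod>b\<in>Basis. ?f b (x \<bullet> b))" for x
  proof -
    have "- 2 * of_real pi * \<i> * of_real (y \<bullet> x) = (\<Sum>b\<in>Basis. - 2 * of_real pi * \<i> * of_real ((y \<bullet> b) * (x \<bullet> b)))"
      by (subst euclidean_inner) (simp add: sum_distrib_left)
    then have "character (y \<bullet> x) = (\<Prod>b\<in>Basis. character ((y \<bullet> b) * (x \<bullet> b)))"
      by (simp only: exp_sum[OF finite_Basis])
    then show ?thesis by (simp only: gaussian_prod prod.distrib)
  qed
  show ?I unfolding eq by (rule integrable_lborel_prod) (rule integrable_exp_square_1)
  have "(\<integral>x. gaussian x * character (y \<bullet> x) \<partial>lborel) = (\<Prod>b\<in>Basis. \<integral>s. ?f b s \<partial>lborel)"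
    unfolding eq by (rule integral_lborel_prod) (rule integrable_exp_square_1)
  also have "\<dots> = of_real (sqrt (2 * pi) ^ DIM('a)) * gaussian ((2 * pi) *\<^sub>R y)"
    unfolding fourier_exp_square_1 gaussian_prod by (simp add: prod.distrib)
  finally show ?E .
qed

lemma integrable_gaussian: "integrable lborel (gaussian :: 'a::euclidean_space \<Rightarrow> complex)"
  using integrable_gaussian_character[of "0 :: 'a"] by simp

lemma integral_gaussian:
  "(\<integral>x. gaussian (x :: 'a::euclidean_space) \<partial>lborel) = of_real (sqrt (2 * pi) ^ DIM('a))"
proof -
  have "gaussian (0 :: 'a) = 1" by (simp add: gaussian_def)
  then show ?thesis using fourier_gaussian[of "0 :: 'a"] by simp
qed

text \<open>The majorant is a constant times the product of the integrable functions \<open>1 / (1 + s\<^sup>2)\<close> of the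
  coordinates; the reciprocal of this product grows at most polynomially.\<close>

lemma schwartz_integrable:
  fixes f :: "'a::euclidean_space \<Rightarrow> complex"
  assumes "schwartz f"
  shows "integrable lborel f"
proof -
  let ?d = "DIM('a)"
  obtain C where C: "\<And>x. norm x ^ 0 * cmod (f x) \<le> C" using schwartz_bound[OF assms] by blast
  obtain D where D: "\<And>x. norm x ^ (2 * ?d) * cmod (f x) \<le> D" using schwartz_bound[OF assms] by blast
  let ?g = "\<lambda>x::'a. of_real (2 ^ ?d * (C + D)) * (\<Prod>b\<in>Basis. complex_of_real (inverse (1 + (x \<bullet> b)\<^sup>2)))"
  have "integrable lborel (\<lambda>s::real. inverse (1 + s\<^sup>2))"
    using integrable_inverse_1_plus_square by (simp add: set_integrable_def)
  then have "integrable lborel (\<lambda>s::real. complex_of_real (inverse (1 + s\<^sup>2)))"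
    by (rule integrable_of_real)
  then have "integrable lborel ?g"
    by (intro integrable_mult_right integrable_lborel_prod)
  then show ?thesis
  proof (rule Bochner_Integration.integrable_bound)
    show "f \<in> borel_measurable lborel"
      using assms smooth_borel_measurable by (auto simp: schwartz_def)
    show "AE x in lborel. cmod (f x) \<le> cmod (?g x)"
    proof (rule AE_I2)
      fix x :: 'a
      have "(\<Prod>b\<in>Basis. 1 + (x \<bullet> b)\<^sup>2) \<le> (\<Prod>b\<in>(Basis :: 'a set). 1 + (norm x)\<^sup>2)"
        by (intro prod_mono) (auto intro!: power_mono simp: Basis_le_norm abs_le_square_iff[symmetric])
      also have "\<dots> = (1 + (norm x)\<^sup>2) ^ ?d" by simp
      also have "\<dots> \<le> 2 ^ ?d * (1 + norm x ^ (2 * ?d))"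
      proof (cases "norm x \<le> 1")
        case True
        then have "(1 + (norm x)\<^sup>2) ^ ?d \<le> 2 ^ ?d * 1"
          by (simp add: power_mono power_le_one)
        also have "\<dots> \<le> 2 ^ ?d * (1 + norm x ^ (2 * ?d))" by (intro mult_left_mono) auto
        finally show ?thesis .
      next
        case False
        then have "(1 + (norm x)\<^sup>2) ^ ?d \<le> (2 * (norm x)\<^sup>2) ^ ?d"
          by (intro power_mono) (simp_all add: one_le_power)
        also have "\<dots> = 2 ^ ?d * norm x ^ (2 * ?d)" by (simp add: power_mult_distrib power_mult)
        also have "\<dots> \<le> 2 ^ ?d * (1 + norm x ^ (2 * ?d))" by (intro mult_left_mono) auto
        finally show ?thesis .
      qed
      finally have "(\<Prod>b\<in>Basis. 1 + (x \<bullet> b)\<^sup>2) * cmod (f x)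
          \<le> 2 ^ ?d * (1 + norm x ^ (2 * ?d)) * cmod (f x)"
        by (rule mult_right_mono) simp
      also have "\<dots> = 2 ^ ?d * (norm x ^ 0 * cmod (f x) + norm x ^ (2 * ?d) * cmod (f x))"
        by (simp add: algebra_simps)
      also have "\<dots> \<le> 2 ^ ?d * (C + D)"
        by (intro mult_left_mono add_mono C D) simp
      finally have le: "(\<Prod>b\<in>Basis. 1 + (x \<bullet> b)\<^sup>2) * cmod (f x) \<le> 2 ^ ?d * (C + D)" .
      have pos: "(\<Prod>b\<in>Basis. 1 + (x \<bullet> b)\<^sup>2) > 0" by (intro prod_pos) (simp add: add_pos_nonneg)
      have "cmod (f x) \<le> 2 ^ ?d * (C + D) / (\<Prod>b\<in>Basis. 1 + (x \<bullet> b)\<^sup>2)"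
        using le pos by (simp add: pos_le_divide_eq mult.commute)
      also have "\<dots> = 2 ^ ?d * (C + D) * (\<Prod>b\<in>Basis. inverse (1 + (x \<bullet> b)\<^sup>2))"
        by (simp add: divide_inverse prod_inversef[symmetric])
      also have "\<dots> \<le> \<bar>2 ^ ?d * (C + D) * (\<Prod>b\<in>Basis. inverse (1 + (x \<bullet> b)\<^sup>2))\<bar>" by (rule abs_ge_self)
      also have "\<dots> = cmod (of_real (2 ^ ?d * (C + D) * (\<Prod>b\<in>Basis. inverse (1 + (x \<bullet> b)\<^sup>2))))"
        by (rule norm_of_real[symmetric])
      finally show "cmod (f x) \<le> cmod (?g x)" by (simp only: of_real_mult of_real_prod)
    qed
  qed
qed

lemma lborel_integral_affine:
  fixes f :: "'a::euclidean_space \<Rightarrow> complex"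
  assumes "f \<in> borel_measurable borel" "c \<noteq> 0"
  shows "(\<integral>x. f x \<partial>lborel) = of_real (\<bar>c\<bar> ^ DIM('a)) * (\<integral>x. f (t + c *\<^sub>R x) \<partial>lborel)"
proof -
  have "(\<integral>x. f x \<partial>lborel) = (\<integral>x. f x \<partial>density (distr lborel borel (\<lambda>x. t + c *\<^sub>R x)) (\<lambda>_. ennreal (\<bar>c\<bar> ^ DIM('a))))"
    by (subst lborel_affine[OF assms(2), of t]) simp
  also have "\<dots> = (\<integral>x. (\<bar>c\<bar> ^ DIM('a)) *\<^sub>R f x \<partial>distr lborel borel (\<lambda>x. t + c *\<^sub>R x))"
    using assms by (intro integral_density) auto
  also have "\<dots> = (\<integral>x. (\<bar>c\<bar> ^ DIM('a)) *\<^sub>R f (t + c *\<^sub>R x) \<partial>lborel)"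
    using assms by (intro integral_distr) auto
  finally show ?thesis by (simp add: scaleR_conv_of_real)
qed

lemma lborel_integrable_affine:
  fixes f :: "'a::euclidean_space \<Rightarrow> complex"
  assumes f: "integrable lborel f" and c: "c \<noteq> 0"
  shows "integrable lborel (\<lambda>x. f (t + c *\<^sub>R x))"
proof -
  have m: "f \<in> borel_measurable borel" using f by simp
  have "integrable (density (distr lborel borel (\<lambda>x. t + c *\<^sub>R x)) (\<lambda>_. ennreal (\<bar>c\<bar> ^ DIM('a)))) f"
    using f lborel_affine[OF c, of t] by simp
  then have "integrable (distr lborel borel (\<lambda>x. t + c *\<^sub>R x)) (\<lambda>x. (\<bar>c\<bar> ^ DIM('a)) *\<^sub>R f x)"
    using m by (subst (asm) integrable_density) auto
  from integrable_scaleR_right[of "inverse (\<bar>c\<bar> ^ DIM('a))", OF this]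
  have "integrable (distr lborel borel (\<lambda>x. t + c *\<^sub>R x)) f"
    using c by simp
  then show ?thesis
    using m by (subst (asm) integrable_distr_eq) auto
qed

lemma integrable_tensor:
  fixes f :: "'a::euclidean_space \<Rightarrow> complex" and g :: "'b::euclidean_space \<Rightarrow> complex"
  assumes f: "integrable lborel f" and g: "integrable lborel g"
    and k: "continuous_on UNIV k" "\<And>z. cmod (k z) \<le> 1"
  shows "integrable (lborel \<Otimes>\<^sub>M lborel) (\<lambda>(x, y). f x * g y * k (x, y))"
proof -
  have [measurable]: "f \<in> borel_measurable borel" "g \<in> borel_measurable borel"
    "k \<in> borel_measurable (borel \<Otimes>\<^sub>M borel)"
    using f g borel_measurable_continuous_onI[OF k(1)] by (simp_all add: borel_prod)
  have "integrable (lborel \<Otimes>\<^sub>M lborel) (\<lambda>(x, y). f x * g y)"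
  proof (rule lborel_pair.Fubini_integrable)
    show "integrable lborel (\<lambda>x. \<integral>y. cmod (case (x, y) of (x, y) \<Rightarrow> f x * g y) \<partial>lborel)"
      using f by (simp add: norm_mult)
  qed (use g in simp_all)
  then show ?thesis
  proof (rule Bochner_Integration.integrable_bound)
    show "(\<lambda>(x, y). f x * g y * k (x, y)) \<in> borel_measurable (lborel \<Otimes>\<^sub>M lborel)"
      by measurable
    show "AE z in lborel \<Otimes>\<^sub>M lborel. cmod (case z of (x, y) \<Rightarrow> f x * g y * k (x, y))
        \<le> cmod (case z of (x, y) \<Rightarrow> f x * g y)"
      by (intro AE_I2) (auto simp: norm_mult intro!: mult_left_le k)
  qed
qed

text \<open>Abel summation: the integral for the inverse transform is damped by a wide Gaussian.  By
  Fubini's theorem the damped integral is an average of \<open>f\<close> against a narrow Gaussian.\<close>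

theorem fourier_inversion:
  fixes f :: "'a::euclidean_space \<Rightarrow> complex"
  assumes f: "test_function f"
  shows "inv_fourier (fourier f) x = f x"
proof -
  define K where "K = complex_of_real (sqrt (2 * pi) ^ DIM('a))"
  define J where "J m = (\<integral>\<omega>. fourier f \<omega> * character (- x \<bullet> \<omega>) * gaussian (\<omega> /\<^sub>R m) \<partial>lborel)" for m
  have fi: "integrable lborel f" using f by (rule test_function_integrable)
  have Fi: "integrable lborel (fourier f)" by (rule schwartz_integrable[OF fourier_schwartz[OF f]])
  have cont: "continuous_on UNIV (\<lambda>y. gaussian (c *\<^sub>R y :: 'a))" for c
    unfolding gaussian_def by (intro continuous_intros) auto
  have contf: "continuous_on UNIV f"
    using f by (intro smooth_continuous_on test_function_smooth)
  have le1: "cmod (gaussian y) \<le> 1" for y :: 'a by (simp add: gaussian_def)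
  have m0: "real (Suc n) \<noteq> 0" for n by simp
  have contc: "continuous_on S (\<lambda>\<omega>. character (y \<bullet> \<omega>))" for S and y :: 'a
    by (intro continuous_intros)
  have "(\<lambda>n. J (real (Suc n))) \<longlonglongrightarrow> (\<integral>\<omega>. fourier f \<omega> * character (- x \<bullet> \<omega>) \<partial>lborel)"
    unfolding J_def
  proof (rule integral_dominated_convergence[where w = "\<lambda>\<omega>. cmod (fourier f \<omega>)"])
    have [measurable]: "fourier f \<in> borel_measurable borel" using Fi by simp
    have [measurable]: "(\<lambda>\<omega>. character (- x \<bullet> \<omega>)) \<in> borel_measurable borel"
      by (intro borel_measurable_continuous_onI contc)
    show "(\<lambda>\<omega>. fourier f \<omega> * character (- x \<bullet> \<omega>)) \<in> borel_measurable lborel" by simp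
    have "(\<lambda>\<omega>::'a. gaussian (\<omega> /\<^sub>R m)) \<in> borel_measurable borel" for m :: real
      by (intro borel_measurable_continuous_onI cont)
    then show "(\<lambda>\<omega>. fourier f \<omega> * character (- x \<bullet> \<omega>) * gaussian (\<omega> /\<^sub>R real (Suc n))) \<in> borel_measurable lborel" for n
      by simp
    show "integrable lborel (\<lambda>\<omega>. cmod (fourier f \<omega>))" using Fi by (rule integrable_norm)
    show "AE \<omega> in lborel. (\<lambda>n. fourier f \<omega> * character (- x \<bullet> \<omega>) * gaussian (\<omega> /\<^sub>R real (Suc n)))
        \<longlonglongrightarrow> fourier f \<omega> * character (- x \<bullet> \<omega>)"
    proof (rule AE_I2)
      fix \<omega> :: 'a
      have "(\<lambda>n. inverse (real (Suc n)) *\<^sub>R \<omega>) \<longlonglongrightarrow> 0 *\<^sub>R \<omega>"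
        by (intro tendsto_scaleR LIMSEQ_inverse_real_of_nat tendsto_const)
      then have "(\<lambda>n. gaussian (\<omega> /\<^sub>R real (Suc n))) \<longlonglongrightarrow> gaussian (0 :: 'a)"
        using continuous_on_tendsto_compose[OF cont[of 1]] by auto
      from tendsto_mult[OF tendsto_const this, of "fourier f \<omega> * character (- x \<bullet> \<omega>)"]
      show "(\<lambda>n. fourier f \<omega> * character (- x \<bullet> \<omega>) * gaussian (\<omega> /\<^sub>R real (Suc n)))
          \<longlonglongrightarrow> fourier f \<omega> * character (- x \<bullet> \<omega>)" by (simp add: gaussian_def[of 0])
    qed
    show "AE \<omega> in lborel. cmod (fourier f \<omega> * character (- x \<bullet> \<omega>) * gaussian (\<omega> /\<^sub>R real (Suc n)))
        \<le> cmod (fourier f \<omega>)" for n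
      unfolding norm_mult norm_character by (auto intro!: AE_I2 mult_left_le le1)
  qed
  then have "(\<lambda>n. J (real (Suc n))) \<longlonglongrightarrow> inv_fourier (fourier f) x"
    by (simp only: inv_fourier_def fourier_def[of "fourier f"])
  moreover have "(\<lambda>n. J (real (Suc n))) \<longlonglongrightarrow> f x"
  proof -
    have damped: "J m = of_real ((1 / (2 * pi)) ^ DIM('a)) * K
        * (\<integral>s. f (x + s /\<^sub>R (2 * pi * m)) * gaussian s \<partial>lborel)" if m: "m > 0" for m
    proof -
      let ?k = "\<lambda>(t, \<omega>). character (\<omega> \<bullet> (t - x))"
      have shrink: "(2 * pi * m) *\<^sub>R (x + (1 / (2 * pi * m)) *\<^sub>R s - x) = s"
        "(1 / (2 * pi * m)) *\<^sub>R s = s /\<^sub>R (2 * pi * m)" for s :: 'a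
        using m by (simp_all add: inverse_eq_divide)
      have abs_eq: "\<bar>1 / (2 * pi * m)\<bar> = 1 / (2 * pi * m)"
        using m by simp
      have gi: "integrable lborel (\<lambda>\<omega>::'a. gaussian (\<omega> /\<^sub>R m))"
        using lborel_integrable_affine[OF integrable_gaussian, of "inverse m" 0] m by simp
      have merge: "character (\<omega> \<bullet> t) * character (- x \<bullet> \<omega>) = character (\<omega> \<bullet> (t - x))" for \<omega> t
        by (simp add: algebra_simps inner_commute flip: exp_add)
      have "J m = (\<integral>\<omega>. \<integral>t. f t * gaussian (\<omega> /\<^sub>R m) * ?k (t, \<omega>) \<partial>lborel \<partial>lborel)"
        unfolding J_def
      proof (rule Bochner_Integration.integral_cong[OF refl])
        fix \<omega> :: 'a
        have "fourier f \<omega> * character (- x \<bullet> \<omega>) * gaussian (\<omega> /\<^sub>R m)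
            = (\<integral>t. f t * character (\<omega> \<bullet> t) * (character (- x \<bullet> \<omega>) * gaussian (\<omega> /\<^sub>R m)) \<partial>lborel)"
          unfolding fourier_def integral_mult_left_zero by (rule mult.assoc)
        also have "\<dots> = (\<integral>t. f t * gaussian (\<omega> /\<^sub>R m) * ?k (t, \<omega>) \<partial>lborel)"
          unfolding prod.case merge[symmetric] by (simp only: mult_ac)
        finally show "fourier f \<omega> * character (- x \<bullet> \<omega>) * gaussian (\<omega> /\<^sub>R m) = \<dots>" .
      qed
      also have "\<dots> = (\<integral>t. \<integral>\<omega>. f t * gaussian (\<omega> /\<^sub>R m) * ?k (t, \<omega>) \<partial>lborel \<partial>lborel)"
      proof (rule lborel_pair.Fubini_integral)
        have "continuous_on UNIV ?k"
          unfolding case_prod_beta by (intro continuous_intros)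
        then show "integrable (lborel \<Otimes>\<^sub>M lborel) (\<lambda>(t, \<omega>). f t * gaussian (\<omega> /\<^sub>R m) * ?k (t, \<omega>))"
          by (intro integrable_tensor fi gi) (auto simp: norm_character simp del: mult_minus_left)
      qed
      also have "\<dots> = (\<integral>t. f t * (of_real (m ^ DIM('a)) * K * gaussian ((2 * pi * m) *\<^sub>R (t - x))) \<partial>lborel)"
      proof (rule Bochner_Integration.integral_cong[OF refl])
        fix t :: 'a
        have "(\<integral>\<omega>. gaussian (\<omega> /\<^sub>R m) * character (\<omega> \<bullet> (t - x)) \<partial>lborel)
            = of_real (\<bar>m\<bar> ^ DIM('a)) * (\<integral>\<omega>. gaussian ((0 + m *\<^sub>R \<omega>) /\<^sub>R m) * character ((0 + m *\<^sub>R \<omega>) \<bullet> (t - x)) \<partial>lborel)"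
          by (rule lborel_integral_affine)
            (use m in \<open>auto intro!: borel_measurable_continuous_onI continuous_on_mult cont continuous_intros\<close>)
        also have "(\<lambda>\<omega>. gaussian ((0 + m *\<^sub>R \<omega>) /\<^sub>R m) * character ((0 + m *\<^sub>R \<omega>) \<bullet> (t - x)))
            = (\<lambda>\<omega>. gaussian \<omega> * character ((m *\<^sub>R (t - x)) \<bullet> \<omega>))"
          using m by (simp add: inner_commute)
        also have "(\<integral>\<omega>. gaussian \<omega> * character ((m *\<^sub>R (t - x)) \<bullet> \<omega>) \<partial>lborel)
            = K * gaussian ((2 * pi * m) *\<^sub>R (t - x))"
          unfolding fourier_gaussian K_def by simp
        finally have inner: "(\<integral>\<omega>. gaussian (\<omega> /\<^sub>R m) * character (\<omega> \<bullet> (t - x)) \<partial>lborel)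
            = of_real (m ^ DIM('a)) * (K * gaussian ((2 * pi * m) *\<^sub>R (t - x)))"
          using m by simp
        have "(\<integral>\<omega>. f t * gaussian (\<omega> /\<^sub>R m) * ?k (t, \<omega>) \<partial>lborel)
            = (\<integral>\<omega>. f t * (gaussian (\<omega> /\<^sub>R m) * character (\<omega> \<bullet> (t - x))) \<partial>lborel)"
          by (simp only: prod.case mult.assoc)
        also have "\<dots> = f t * (of_real (m ^ DIM('a)) * (K * gaussian ((2 * pi * m) *\<^sub>R (t - x))))"
          unfolding integral_mult_right_zero inner ..
        finally show "(\<integral>\<omega>. f t * gaussian (\<omega> /\<^sub>R m) * ?k (t, \<omega>) \<partial>lborel)
            = f t * (of_real (m ^ DIM('a)) * K * gaussian ((2 * pi * m) *\<^sub>R (t - x)))"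
          by (simp only: mult.assoc)
      qed
      also have "\<dots> = of_real (\<bar>1 / (2 * pi * m)\<bar> ^ DIM('a)) * (\<integral>s. f (x + (1 / (2 * pi * m)) *\<^sub>R s)
          * (of_real (m ^ DIM('a)) * K * gaussian ((2 * pi * m) *\<^sub>R (x + (1 / (2 * pi * m)) *\<^sub>R s - x))) \<partial>lborel)"
        by (rule lborel_integral_affine)
          (use m in \<open>auto intro!: borel_measurable_continuous_onI continuous_intros contf simp: gaussian_def\<close>)
      also have "(\<lambda>s. f (x + (1 / (2 * pi * m)) *\<^sub>R s)
          * (of_real (m ^ DIM('a)) * K * gaussian ((2 * pi * m) *\<^sub>R (x + (1 / (2 * pi * m)) *\<^sub>R s - x))))
          = (\<lambda>s. (of_real (m ^ DIM('a)) * K) * (f (x + s /\<^sub>R (2 * pi * m)) * gaussian s))"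
        unfolding shrink(1) unfolding shrink(2) by (simp only: mult_ac)
      also have "of_real (\<bar>1 / (2 * pi * m)\<bar> ^ DIM('a)) * (\<integral>s. (of_real (m ^ DIM('a)) * K) * (f (x + s /\<^sub>R (2 * pi * m)) * gaussian s) \<partial>lborel)
          = of_real ((1 / (2 * pi * m)) ^ DIM('a) * m ^ DIM('a)) * K * (\<integral>s. f (x + s /\<^sub>R (2 * pi * m)) * gaussian s \<partial>lborel)"
        unfolding abs_eq integral_mult_right_zero of_real_mult by (simp only: mult_ac)
      also have "(1 / (2 * pi * m)) ^ DIM('a) * m ^ DIM('a) = (1 / (2 * pi)) ^ DIM('a)"
        using m by (simp add: power_mult_distrib[symmetric])
      finally show ?thesis .
    qed
    have "(\<lambda>n. \<integral>s. f (x + s /\<^sub>R (2 * pi * real (Suc n))) * gaussian s \<partial>lborel) \<longlonglongrightarrow> (\<integral>s. f x * gaussian (s :: 'a) \<partial>lborel)"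
    proof -
      obtain M where M: "\<And>y. cmod (f y) \<le> M" using test_function_bounded[OF f] by metis
      have [measurable]: "f \<in> borel_measurable borel" using fi by simp
      have [measurable]: "gaussian \<in> borel_measurable (borel :: 'a measure)"
        using borel_measurable_continuous_onI[OF cont[of 1]] by simp
      show ?thesis
      proof (rule integral_dominated_convergence[where w = "\<lambda>s::'a. M * cmod (gaussian s)"])
        show "integrable lborel (\<lambda>s::'a. M * cmod (gaussian s))"
          by (intro integrable_mult_right integrable_norm integrable_gaussian)
        show "AE s in lborel. cmod (f (x + s /\<^sub>R (2 * pi * real (Suc n))) * gaussian s) \<le> M * cmod (gaussian s)" for n
          unfolding norm_mult by (intro AE_I2 mult_right_mono M) simp
        show "AE s in lborel. (\<lambda>n. f (x + s /\<^sub>R (2 * pi * real (Suc n))) * gaussian s) \<longlonglongrightarrow> f x * gaussian s"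
        proof (rule AE_I2, intro tendsto_mult tendsto_const)
          fix s :: 'a
          have "(\<lambda>n. x + (inverse (2 * pi) * inverse (real (Suc n))) *\<^sub>R s) \<longlonglongrightarrow> x + (inverse (2 * pi) * 0) *\<^sub>R s"
            by (intro tendsto_add tendsto_scaleR tendsto_mult LIMSEQ_inverse_real_of_nat tendsto_const)
          then have "(\<lambda>n. x + s /\<^sub>R (2 * pi * real (Suc n))) \<longlonglongrightarrow> x"
            by (simp only: inverse_mult_distrib[of "2 * pi" "real (Suc _)"] mult_zero_right
                scaleR_zero_left add_0_right)
          then show "(\<lambda>n. f (x + s /\<^sub>R (2 * pi * real (Suc n)))) \<longlonglongrightarrow> f x"
            by (rule isCont_tendsto_compose[OF smooth_isCont[OF test_function_smooth[OF f]]])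
        qed
      qed simp_all
    qed
    then have "(\<lambda>n. of_real ((1 / (2 * pi)) ^ DIM('a)) * K
        * (\<integral>s. f (x + s /\<^sub>R (2 * pi * real (Suc n))) * gaussian s \<partial>lborel))
        \<longlonglongrightarrow> of_real ((1 / (2 * pi)) ^ DIM('a)) * K * (\<integral>s. f x * gaussian (s :: 'a) \<partial>lborel)"
      by (intro tendsto_mult tendsto_const)
    then have "(\<lambda>n. J (real (Suc n))) \<longlonglongrightarrow> of_real ((1 / (2 * pi)) ^ DIM('a)) * K * (\<integral>s. f x * gaussian (s :: 'a) \<partial>lborel)"
      by (simp only: damped[OF of_nat_0_less_iff[THEN iffD2, OF zero_less_Suc]])
    moreover have "of_real ((1 / (2 * pi)) ^ DIM('a)) * K * (\<integral>s. f x * gaussian (s :: 'a) \<partial>lborel) = f x"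
    proof -
      have "(1 / (2 * pi)) ^ DIM('a) * (sqrt (2 * pi) ^ DIM('a) * sqrt (2 * pi) ^ DIM('a))
          = (1 / (2 * pi) * (sqrt (2 * pi) * sqrt (2 * pi))) ^ DIM('a)"
        by (simp only: power_mult_distrib)
      also have "\<dots> = 1" by simp
      finally have "complex_of_real ((1 / (2 * pi)) ^ DIM('a) * (sqrt (2 * pi) ^ DIM('a) * sqrt (2 * pi) ^ DIM('a)))
          = of_real 1" by (rule arg_cong)
      then
      have "complex_of_real ((1 / (2 * pi)) ^ DIM('a)) * (K * K) = 1"
        unfolding K_def of_real_mult of_real_1 .
      moreover have "(\<integral>s. f x * gaussian (s :: 'a) \<partial>lborel) = f x * K"
        unfolding integral_mult_right_zero integral_gaussian K_def ..
      moreover have "c * K * (f x * K) = f x * (c * (K * K))" for c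
        by simp
      ultimately show ?thesis by (simp only: mult_1_right)
    qed
    ultimately show ?thesis by (simp only:)
  qed
  ultimately show ?thesis by (rule LIMSEQ_unique)
qed

section \<open>Functionals determined by symmetric products\<close>

text \<open>The property \<open>product\<close> expresses that \<open>u f * cnj (u g)\<close> depends only on the products of values of
  \<open>f\<close> and \<open>cnj g\<close> at points symmetric about some element of \<open>A\<close>.  A combination of point masses on
  \<open>A\<close> need not have it, since \<open>f a\<close> and \<open>g b\<close> with \<open>a \<noteq> b\<close> interact; it is the footprint of a Wigner
  transform that is carried by fibres over \<open>A\<close>.\<close>

locale symmetric_product_functional =
  fixes u :: "'a::euclidean_space distr" and A :: "'a set"
  assumes add: "\<lbrakk>test_function f; test_function g\<rbrakk> \<Longrightarrow> u (\<lambda>x. f x + g x) = u f + u g"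
    and scale: "test_function f \<Longrightarrow> u (\<lambda>x. c * f x) = cnj c * u f"
    and product: "\<lbrakk>test_function f; test_function g; test_function f'; test_function g';
        \<And>a t. a \<in> A \<Longrightarrow> f (a + t) * cnj (g (a - t)) = f' (a + t) * cnj (g' (a - t))\<rbrakk>
      \<Longrightarrow> u f * cnj (u g) = u f' * cnj (u g')"
    and uniform_discrete: "uniform_discrete A"
begin

lemma zero: "u (\<lambda>x. 0) = 0"
  using scale[OF test_function_zero, of 0] by simp

lemma diff: "\<lbrakk>test_function f; test_function g\<rbrakk> \<Longrightarrow> u (\<lambda>x. f x - g x) = u f - u g"
  using add[of f "\<lambda>x. (-1) * g x"] scale[of g "-1"] test_function_mult'[OF _ smooth_const, of g "-1"]
  by simp

lemma sum: "\<lbrakk>finite I; \<And>i. i \<in> I \<Longrightarrow> test_function (F i)\<rbrakk> \<Longrightarrow> u (\<lambda>x. \<Sum>i\<in>I. F i x) = (\<Sum>i\<in>I. u (F i))"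
  by (induction I rule: finite_induct) (auto simp: zero add test_function_sum)

lemma midpoint_mem_ball:
  fixes a :: 'a
  assumes "a + t \<in> ball p r" "a - t \<in> ball p r"
  shows "a \<in> ball p r"
proof -
  have "(1 / 2) *\<^sub>R (a + t) + (1 / 2) *\<^sub>R (a - t) \<in> ball p r"
    using assms by (intro convexD[OF convex_ball]) auto
  moreover have "(1 / 2) *\<^sub>R (a + t) + (1 / 2) *\<^sub>R (a - t) = a"
    by (simp add: scaleR_add_right scaleR_diff_right flip: scaleR_add_left)
  ultimately show ?thesis by simp
qed

text \<open>A ball that contains \<open>a + t\<close> and \<open>a - t\<close> contains their midpoint \<open>a\<close>.  Hence all symmetric products
  of \<open>f\<close> with itself vanish on \<open>A\<close>, and \<open>u f * cnj (u f) = 0\<close>.\<close>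

lemma null_away_from_A:
  assumes f: "test_function f" and supp: "\<And>x. f x \<noteq> 0 \<Longrightarrow> x \<in> ball p r" and disj: "ball p r \<inter> A = {}"
  shows "u f = 0"
proof -
  have "f (a + t) * cnj (f (a - t)) = 0 * cnj 0" if "a \<in> A" for a t
    using that disj supp midpoint_mem_ball[of a t p r] by auto
  then have "u f * cnj (u f) = u (\<lambda>x. 0) * cnj (u (\<lambda>x. 0))"
    by (intro product f test_function_zero)
  then show ?thesis by (simp add: zero)
qed

text \<open>For functions supported in the ball, only the symmetry about \<open>p\<close> contributes.  The factor
  \<open>m (p + t)\<close> can then be passed from the first function to the second, where it appears reflected
  about \<open>p\<close> and conjugated.  Keeping the second function equal to \<open>f\<close> and dividing by \<open>cnj (u f)\<close>
  gives the eigenvalue.\<close>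

lemma multiplier_eigenvalue:
  assumes iso: "ball p r \<inter> A \<subseteq> {p}" and m: "smooth m"
    and f: "test_function f" "\<And>x. f x \<noteq> 0 \<Longrightarrow> x \<in> ball p r" and nz: "u f \<noteq> 0"
  shows "\<exists>\<kappa>. \<forall>k. test_function k \<and> (\<forall>x. k x \<noteq> 0 \<longrightarrow> x \<in> ball p r) \<longrightarrow> u (\<lambda>x. m x * k x) = \<kappa> * u k"
proof -
  \<comment> \<open>\<open>cnj m\<close> reflected about \<open>p\<close>\<close>
  define m' where "m' x = cnj (m (2 *\<^sub>R p - x))" for x
  have "smooth m'"
    unfolding m'_def
    using smooth_cnj[OF smooth_affine[OF linear_uminus m, of "2 *\<^sub>R p"]] by simp
  then have m'f: "test_function (\<lambda>x. m' x * f x)" by (rule test_function_mult'[OF f(1)])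
  have "u (\<lambda>x. m x * k x) = cnj (u (\<lambda>x. m' x * f x)) / cnj (u f) * u k"
    if k: "test_function k" "\<forall>x. k x \<noteq> 0 \<longrightarrow> x \<in> ball p r" for k
  proof -
    have "u (\<lambda>x. m x * k x) * cnj (u f) = u k * cnj (u (\<lambda>x. m' x * f x))"
    proof (rule product)
      fix a t assume "a \<in> A"
      show "m (a + t) * k (a + t) * cnj (f (a - t)) = k (a + t) * cnj (m' (a - t) * f (a - t))"
      proof (cases "k (a + t) = 0 \<or> f (a - t) = 0")
        case False
        then have "a \<in> ball p r" using k f(2) midpoint_mem_ball by blast
        then have "a = p" using iso \<open>a \<in> A\<close> by blast
        then have "m' (a - t) = cnj (m (a + t))" by (simp add: m'_def scaleR_2)
        then show ?thesis by simp
      qed auto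
    qed (use test_function_mult'[OF k(1) m] f(1) k(1) m'f in auto)
    then show ?thesis using nz by (simp add: field_simps)
  qed
  then show ?thesis by blast
qed

text \<open>A partition of unity without division: if \<open>\<rho> c\<close> equals \<open>1\<close> on small balls that cover the support of
  \<open>f\<close>, then \<open>f\<close> times the product of all \<open>1 - \<rho> c\<close> is zero, while each factor \<open>1 - \<rho> c\<close> changes \<open>u\<close>
  only by a term that is null by the local assumption.\<close>

lemma locally_null_imp_null:
  assumes f: "test_function f"
    and loc: "\<And>x. \<exists>r>0. \<forall>\<rho>. smooth \<rho> \<and> (\<forall>y. r \<le> dist x y \<longrightarrow> \<rho> y = 0) \<longrightarrow> u (\<lambda>y. f y * \<rho> y) = 0"
  shows "u f = 0"
proof -
  obtain R where R: "\<And>x. norm x > R \<Longrightarrow> f x = 0" using f test_function_iff by metis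
  obtain r where r: "\<And>x. r x > 0"
    and null: "\<And>x \<rho>. smooth \<rho> \<Longrightarrow> (\<And>y. r x \<le> dist x y \<Longrightarrow> \<rho> y = 0) \<Longrightarrow> u (\<lambda>y. f y * \<rho> y) = 0"
    using loc by metis
  have "\<exists>\<rho>. smooth \<rho> \<and> (\<forall>y. dist x y \<le> r x / 2 \<longrightarrow> \<rho> y = 1) \<and> (\<forall>y. r x \<le> dist x y \<longrightarrow> \<rho> y = 0)" for x
    using bump_function_exists[of "r x / 2" "r x" x] r[of x] by (metis half_gt_zero less_imp_le field_sum_of_halves less_add_same_cancel1)
  then obtain \<rho> where \<rho>: "\<And>x. smooth (\<rho> x)" "\<And>x y. dist x y \<le> r x / 2 \<Longrightarrow> \<rho> x y = 1"
    "\<And>x y. r x \<le> dist x y \<Longrightarrow> \<rho> x y = 0"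
    by metis
  have "cball 0 R \<subseteq> (\<Union>x\<in>cball 0 R. ball x (r x / 2))"
    using r by force
  then obtain C where C: "finite C" "cball 0 R \<subseteq> (\<Union>x\<in>C. ball x (r x / 2))"
    using compactE_image[OF compact_cball, of "cball 0 R" "\<lambda>x. ball x (r x / 2)" 0 R] by (metis open_ball)
  have "u (\<lambda>y. f y * (\<Prod>c\<in>C. 1 - \<rho> c y)) = u f"
    using C(1)
  proof (induction C rule: finite_induct)
    case (insert c C)
    let ?P = "\<lambda>y. \<Prod>c\<in>C. 1 - \<rho> c y"
    have P: "smooth ?P" by (intro smooth_prod smooth_diff smooth_const \<rho>(1) insert)
    have "u (\<lambda>y. f y * (\<Prod>c\<in>insert c C. 1 - \<rho> c y)) = u (\<lambda>y. f y * ?P y - f y * (\<rho> c y * ?P y))"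
      using insert by (simp add: algebra_simps)
    also have "\<dots> = u (\<lambda>y. f y * ?P y) - u (\<lambda>y. f y * (\<rho> c y * ?P y))"
      by (intro diff test_function_mult f smooth_mult P \<rho>(1))
    also have "u (\<lambda>y. f y * (\<rho> c y * ?P y)) = 0"
      by (rule null[of _ c]) (use smooth_mult[OF \<rho>(1) P] \<rho>(3) in auto)
    finally show ?case using insert by simp
  qed simp
  moreover have "f y * (\<Prod>c\<in>C. 1 - \<rho> c y) = 0" for y
  proof (cases "norm y > R")
    case False
    then obtain c where "c \<in> C" "y \<in> ball c (r c / 2)" using C(2) by force
    then have "1 - \<rho> c y = 0" using \<rho>(2) by simp
    then show ?thesis using C(1) \<open>c \<in> C\<close> by (auto intro: prod_zero)
  qed (simp add: R)
  ultimately show ?thesis by (simp add: zero)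
qed

lemma closed_A: "closed A"
  by (rule uniform_discrete_imp_closed[OF uniform_discrete])

lemma locally_null_off_A:
  assumes f: "test_function f" and "x \<notin> A"
  shows "\<exists>r>0. \<forall>\<rho>. smooth \<rho> \<and> (\<forall>y. r \<le> dist x y \<longrightarrow> \<rho> y = 0) \<longrightarrow> u (\<lambda>y. f y * \<rho> y) = 0"
proof -
  obtain r where "r > 0" and r: "ball x r \<subseteq> - A"
    using closed_A \<open>x \<notin> A\<close> openE[of "- A" x] by (auto simp: open_Compl)
  have "u (\<lambda>y. f y * \<rho> y) = 0" if "smooth \<rho>" "\<forall>y. r \<le> dist x y \<longrightarrow> \<rho> y = 0" for \<rho>
    by (rule null_away_from_A[of _ x r]) (use that r test_function_mult[OF f] in \<open>auto simp: not_le[symmetric]\<close>)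
  then show ?thesis using \<open>r > 0\<close> by blast
qed

text \<open>This excludes derivatives of point masses.  Let \<open>\<kappa>\<close> be the eigenvalue of multiplication by \<open>f\<close>
  itself.  It is not zero, as \<open>f = f * \<rho>\<close> for a bump function \<open>\<rho>\<close> and \<open>u f \<noteq> 0\<close>.  Since \<open>u\<close> is
  antilinear, \<open>f - cnj \<kappa>\<close> annihilates \<open>u\<close> on the ball; because \<open>f p = 0\<close>, this function is invertible
  near \<open>p\<close>, so that \<open>u\<close> vanishes near \<open>p\<close>.  It vanishes near all other points of the support of \<open>f\<close>
  as well, and localization yields \<open>u f = 0\<close>.\<close>

lemma null_near_isolated_point:
  assumes iso: "ball p r \<inter> A \<subseteq> {p}" and s: "0 \<le> s" "s < r"
    and f: "test_function f" and supp: "\<And>x. f x \<noteq> 0 \<Longrightarrow> dist p x \<le> s" and fp: "f p = 0"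
  shows "u f = 0"
proof (rule ccontr)
  assume nz: "u f \<noteq> 0"
  have sf: "smooth f" using f by (rule test_function_smooth)
  have supp': "x \<in> ball p r" if "f x \<noteq> 0" for x using supp[OF that] s by simp
  obtain \<kappa> where \<kappa>: "\<And>k. test_function k \<Longrightarrow> (\<And>x. k x \<noteq> 0 \<Longrightarrow> x \<in> ball p r) \<Longrightarrow> u (\<lambda>x. f x * k x) = \<kappa> * u k"
    using multiplier_eigenvalue[OF iso sf f supp' nz] by metis
  have "\<kappa> \<noteq> 0"
  proof
    assume "\<kappa> = 0"
    obtain \<rho> where \<rho>: "smooth \<rho>" "\<And>x. dist p x \<le> s \<Longrightarrow> \<rho> x = 1" "\<And>x. r \<le> dist p x \<Longrightarrow> \<rho> x = 0"
      using bump_function_exists[OF s, of p] by metis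
    have "(\<lambda>x. f x * \<rho> x) = f" using \<rho>(2) supp by fastforce
    moreover have "u (\<lambda>x. f x * \<rho> x) = \<kappa> * u \<rho>"
      by (rule \<kappa>) (use bump_is_test_function[OF \<rho>(1,3)] \<rho>(3) in \<open>auto simp: not_le[symmetric]\<close>)
    ultimately show False using nz \<open>\<kappa> = 0\<close> by simp
  qed
  then have "cmod \<kappa> / 2 > 0" by simp
  then obtain e where "e > 0" and e: "\<And>x. dist x p < e \<Longrightarrow> dist (f x) (f p) < cmod \<kappa> / 2"
    using smooth_isCont[OF sf, of p] unfolding continuous_at_eps_delta by metis
  obtain \<rho> where \<rho>: "smooth \<rho>" "\<And>x. dist p x \<le> e / 2 \<Longrightarrow> \<rho> x = 1" "\<And>x. e \<le> dist p x \<Longrightarrow> \<rho> x = 0"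
    "\<And>x. cmod (\<rho> x) \<le> 1"
    using bump_function_exists[of "e / 2" e p] \<open>e > 0\<close> by auto
  \<comment> \<open>agrees with \<open>f - cnj \<kappa>\<close> near \<open>p\<close>; the cut-off keeps it away from zero everywhere, so that its
    reciprocal is smooth\<close>
  define m where "m x = \<rho> x * f x - cnj \<kappa>" for x
  have "smooth m" unfolding m_def by (intro smooth_diff smooth_mult smooth_const \<rho>(1) sf)
  have m_nz: "m x \<noteq> 0" for x
  proof -
    have "cmod (\<rho> x * f x) \<le> cmod \<kappa> / 2"
    proof (cases "dist p x < e")
      case True
      then have "cmod (f x) \<le> cmod \<kappa> / 2" using e[of x] fp by (simp add: dist_commute)
      then have "cmod (\<rho> x) * cmod (f x) \<le> 1 * (cmod \<kappa> / 2)"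
        by (intro mult_mono \<rho>(4)) auto
      then show ?thesis by (simp add: norm_mult)
    qed (use \<rho>(3) in auto)
    then have "cmod (\<rho> x * f x) < cmod \<kappa>" using \<open>cmod \<kappa> / 2 > 0\<close> by linarith
    then have "\<rho> x * f x \<noteq> cnj \<kappa>" by (metis complex_mod_cnj less_irrefl)
    then show ?thesis by (simp add: m_def)
  qed
  have "u f = 0"
  proof (rule locally_null_imp_null[OF f])
    fix x
    consider "x \<notin> A" | "x \<in> A" "x \<noteq> p" | "x = p" by blast
    then show "\<exists>r>0. \<forall>\<rho>. smooth \<rho> \<and> (\<forall>y. r \<le> dist x y \<longrightarrow> \<rho> y = 0) \<longrightarrow> u (\<lambda>y. f y * \<rho> y) = 0"
    proof cases
      case 1
      then show ?thesis by (rule locally_null_off_A[OF f])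
    next
      case 2
      then have far: "r \<le> dist p x" using iso by (auto simp: not_less[symmetric])
      have "u (\<lambda>y. f y * \<sigma> y) = 0" if "\<forall>y. r - s \<le> dist x y \<longrightarrow> \<sigma> y = 0" for \<sigma>
      proof -
        have "f y * \<sigma> y = 0" for y
          using that supp[of y] far dist_triangle[of p x y] by (force simp: dist_commute)
        then show ?thesis by (simp only: zero)
      qed
      then show ?thesis using s by (intro exI[of _ "r - s"]) auto
    next
      case 3
      have "u (\<lambda>y. f y * \<sigma> y) = 0" if \<sigma>: "smooth \<sigma>" "\<forall>y. e / 2 \<le> dist p y \<longrightarrow> \<sigma> y = 0" for \<sigma>
      proof -
        define k where "k y = f y * \<sigma> y * inverse (m y)" for y
        have k: "test_function k"
          unfolding k_def
          by (intro test_function_mult[OF test_function_mult[OF f \<sigma>(1)]] smooth_inverse m_nz \<open>smooth m\<close>)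
        have "u (\<lambda>x. f x * k x) = \<kappa> * u k"
          by (rule \<kappa>[OF k]) (use supp' in \<open>auto simp: k_def\<close>)
        then have "u (\<lambda>x. f x * k x) - u (\<lambda>x. cnj \<kappa> * k x) = 0"
          by (simp add: scale[OF k])
        then have "u (\<lambda>x. f x * k x - cnj \<kappa> * k x) = 0"
          using diff[OF test_function_mult'[OF k sf] test_function_mult'[OF k smooth_const]] by simp
        moreover have "f y * k y - cnj \<kappa> * k y = f y * \<sigma> y" for y
        proof (cases "e / 2 \<le> dist p y")
          case False
          then have "f y - cnj \<kappa> = m y" using \<rho>(2) by (simp add: m_def)
          then have "f y * k y - cnj \<kappa> * k y = m y * k y" by (simp add: algebra_simps)
          then show ?thesis using m_nz[of y] by (simp add: k_def)
        qed (use \<sigma> in \<open>simp add: k_def\<close>)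
        ultimately show ?thesis by simp
      qed
      then show ?thesis using \<open>e > 0\<close> 3 by (intro exI[of _ "e / 2"]) auto
    qed
  qed
  with nz show False by blast
qed

lemma null_if_vanishes_on_A:
  assumes f: "test_function f" and fA: "\<And>a. a \<in> A \<Longrightarrow> f a = 0"
  shows "u f = 0"
proof (rule locally_null_imp_null[OF f])
  fix x
  obtain e where "e > 0" and e: "\<And>a b. a \<in> A \<Longrightarrow> b \<in> A \<Longrightarrow> dist a b < e \<Longrightarrow> a = b"
    using uniform_discrete by (auto simp: uniform_discrete_def)
  show "\<exists>r>0. \<forall>\<rho>. smooth \<rho> \<and> (\<forall>y. r \<le> dist x y \<longrightarrow> \<rho> y = 0) \<longrightarrow> u (\<lambda>y. f y * \<rho> y) = 0"
  proof (cases "x \<in> A")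
    case True
    have iso: "ball x e \<inter> A \<subseteq> {x}" using e[OF True] by force
    have "u (\<lambda>y. f y * \<rho> y) = 0" if "smooth \<rho>" "\<forall>y. e / 2 \<le> dist x y \<longrightarrow> \<rho> y = 0" for \<rho>
    proof (rule null_near_isolated_point[of x e "e / 2"])
      show "dist x y \<le> e / 2" if "f y * \<rho> y \<noteq> 0" for y
        using that \<open>\<forall>y. e / 2 \<le> dist x y \<longrightarrow> \<rho> y = 0\<close> by (metis linear mult_zero_right)
    qed (use that True iso \<open>e > 0\<close> fA test_function_mult[OF f] in auto)
    then show ?thesis using \<open>e > 0\<close> by (intro exI[of _ "e / 2"]) auto
  qed (rule locally_null_off_A[OF f])
qed

text \<open>The weight of \<open>a\<close> is the value of \<open>u\<close> on a bump function that is \<open>1\<close> at \<open>a\<close> and vanishes at the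
  other points of \<open>A\<close>.  The finite set \<open>F\<close> is left free so that any finite set which contains the
  points of \<open>A\<close> where \<open>f\<close> does not vanish can be used.\<close>

theorem combination_of_point_masses:
  "\<exists>w. \<forall>f F. test_function f \<longrightarrow> finite F \<longrightarrow> F \<subseteq> A \<longrightarrow> (\<forall>a\<in>A - F. f a = 0) \<longrightarrow> u f = (\<Sum>a\<in>F. w a * cnj (f a))"
proof -
  obtain e where "e > 0" and e: "\<And>a b. a \<in> A \<Longrightarrow> b \<in> A \<Longrightarrow> dist a b < e \<Longrightarrow> a = b"
    using uniform_discrete by (auto simp: uniform_discrete_def)
  have "\<exists>\<rho>. test_function \<rho> \<and> \<rho> a = 1 \<and> (\<forall>b\<in>A. b \<noteq> a \<longrightarrow> \<rho> b = 0)" if "a \<in> A" for a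
  proof -
    obtain \<rho> where \<rho>: "smooth \<rho>" "\<And>x. dist a x \<le> 0 \<Longrightarrow> \<rho> x = 1" "\<And>x. e \<le> dist a x \<Longrightarrow> \<rho> x = 0"
      using bump_function_exists[OF order_refl \<open>e > 0\<close>, of a] by metis
    have "\<rho> b = 0" if "b \<in> A" "b \<noteq> a" for b
      using e[OF \<open>a \<in> A\<close> \<open>b \<in> A\<close>] that \<rho>(3) by (metis not_less)
    moreover have "test_function \<rho>" by (rule bump_is_test_function[OF \<rho>(1,3)])
    ultimately show ?thesis using \<rho>(2)[of a] by auto
  qed
  then obtain \<beta> where \<beta>: "\<And>a. a \<in> A \<Longrightarrow> test_function (\<beta> a)" "\<And>a. a \<in> A \<Longrightarrow> \<beta> a a = 1"
    "\<And>a b. a \<in> A \<Longrightarrow> b \<in> A \<Longrightarrow> b \<noteq> a \<Longrightarrow> \<beta> a b = 0"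
    by metis
  have "u f = (\<Sum>a\<in>F. u (\<beta> a) * cnj (f a))"
    if f: "test_function f" and F: "finite F" "F \<subseteq> A" "\<forall>a\<in>A - F. f a = 0" for f F
  proof -
    let ?s = "\<lambda>x. \<Sum>a\<in>F. f a * \<beta> a x"
    have t: "test_function (\<lambda>x. f a * \<beta> a x)" if "a \<in> F" for a
      using test_function_mult'[OF \<beta>(1) smooth_const] that F by blast
    have ts: "test_function ?s" by (intro test_function_sum F t)
    have "u (\<lambda>x. f x - ?s x) = 0"
    proof (rule null_if_vanishes_on_A)
      fix b assume b: "b \<in> A"
      have "?s b = (\<Sum>a\<in>F. if a = b then f b else 0)"
        using \<beta>(2,3) F b by (intro sum.cong) auto
      then show "f b - ?s b = 0" using F b by (auto simp: sum.delta)
    qed (intro test_function_diff f ts)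
    then have "u f = u ?s" using diff[OF f ts] by simp
    also have "\<dots> = (\<Sum>a\<in>F. u (\<lambda>x. f a * \<beta> a x))"
      by (intro sum F t)
    also have "\<dots> = (\<Sum>a\<in>F. u (\<beta> a) * cnj (f a))"
      using \<beta>(1) F scale by (intro sum.cong refl) (auto simp: mult.commute)
    finally show ?thesis .
  qed
  then show ?thesis by (intro exI[of _ "\<lambda>a. u (\<beta> a)"] allI impI)
qed

end

section \<open>Combinations of point masses on a uniformly discrete set\<close>

lemma finite_uniform_discrete_bounded:
  fixes A :: "'a::euclidean_space set"
  shows "uniform_discrete A \<Longrightarrow> bounded E \<Longrightarrow> finite (A \<inter> E)"
  using uniform_discrete_finite_iff bounded_subset
  by (metis inf_le1 inf_le2 uniform_discrete_subset)

lemma sums_disjoint_family: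
  fixes w :: "'a \<Rightarrow> 'b::real_normed_vector"
  assumes E: "disjoint_family E" and fin: "finite (A \<inter> (\<Union>i. E i))"
  shows "(\<lambda>i::nat. \<Sum>a\<in>A \<inter> E i. w a) sums (\<Sum>a\<in>A \<inter> (\<Union>i. E i). w a)"
proof -
  let ?F = "A \<inter> (\<Union>i. E i)"
  have "(\<lambda>i. if a \<in> E i then w a else 0) sums w a" if "a \<in> ?F" for a
  proof -
    from that obtain j where j: "a \<in> E j" by (elim IntE UN_E)
    then have "(a \<in> E i) = (i = j)" for i
      using E by (auto simp: disjoint_family_on_def)
    then show ?thesis using sums_single[of j "\<lambda>_. w a"] by simp
  qed
  then have "(\<lambda>i. \<Sum>a\<in>?F. if a \<in> E i then w a else 0) sums (\<Sum>a\<in>?F. w a)"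
    by (intro sums_sum) auto
  moreover have "(\<Sum>a\<in>?F. if a \<in> E i then w a else 0) = (\<Sum>a\<in>A \<inter> E i. w a)" for i
    using fin by (simp add: sum.inter_filter[symmetric]) (intro sum.cong, auto)
  ultimately show ?thesis by simp
qed

text \<open>The total variation measure has mass \<open>cmod (w a)\<close> at \<open>a\<close>, and the density \<open>h\<close> is the phase of
  \<open>w\<close>.\<close>

theorem point_masses_is_measure_distr:
  fixes A :: "'a::euclidean_space set" and w :: "'a \<Rightarrow> complex"
  assumes A: "uniform_discrete A"
    and T: "\<And>f F. \<lbrakk>test_function f; finite F; F \<subseteq> A; \<forall>a\<in>A - F. f a = 0\<rbrakk> \<Longrightarrow> T f = (\<Sum>a\<in>F. w a * cnj (f a))"
  shows "is_measure_distr T"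
proof -
  define \<nu> where "\<nu> E = (\<Sum>a\<in>A \<inter> E. w a)" for E
  define M where "M = distr (density (count_space A) (\<lambda>a. ennreal (cmod (w a)))) borel (\<lambda>x. x)"
  \<comment> \<open>the value \<open>1\<close> where there is no mass makes \<open>h\<close> unimodular everywhere\<close>
  define h where "h x = (if x \<in> A \<and> w x \<noteq> 0 then w x / of_real (cmod (w x)) else 1)" for x
  have closed_sub: "closed B" if "B \<subseteq> A" for B
    using uniform_discrete_imp_closed[OF uniform_discrete_subset[OF A that]] .
  have h[measurable]: "h \<in> borel_measurable borel"
  proof (rule measurableI)
    fix S :: "complex set"
    have eq: "h -` S \<inter> space borel = (A \<inter> h -` S) \<union> (if 1 \<in> S then - A else {})"
      by (auto simp: h_def split: if_splits)
    have "A \<inter> h -` S \<in> sets borel" "- A \<in> sets borel"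
      using closed_sub[of "A \<inter> h -` S"] closed_sub[of A] by (auto intro: borel_closed borel_comp)
    then show "h -` S \<inter> space borel \<in> sets borel" unfolding eq by auto
  qed simp
  have norm_h: "cmod (h x) = 1" for x by (simp add: h_def norm_divide)
  have wh: "of_real (cmod (w a)) * h a = w a" if "a \<in> A" for a
    using that by (simp add: h_def)
  have id[measurable]: "(\<lambda>x. x) \<in> measurable (density (count_space A) (\<lambda>a. ennreal (cmod (w a)))) borel"
    by simp
  have integral_M: "(\<integral>x. g x \<partial>M) = (\<Sum>a\<in>F. of_real (cmod (w a)) * g a)"
    if g: "g \<in> borel_measurable borel" and F: "finite F" "F \<subseteq> A" "\<forall>a\<in>A - F. g a = 0"
    for g :: "'a \<Rightarrow> complex" and F
  proof -
    have "(\<integral>x. g x \<partial>M) = (\<integral>x. g x \<partial>density (count_space A) (\<lambda>a. ennreal (cmod (w a))))"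
      unfolding M_def by (rule integral_distr[OF id g])
    also have "\<dots> = (\<integral>a. cmod (w a) *\<^sub>R g a \<partial>count_space A)"
      by (rule integral_density) auto
    also have "\<dots> = (\<Sum>a | a \<in> A \<and> cmod (w a) *\<^sub>R g a \<noteq> 0. cmod (w a) *\<^sub>R g a)"
      by (rule lebesgue_integral_count_space_finite_support)
        (rule finite_subset[OF _ F(1)], use F in auto)
    also have "\<dots> = (\<Sum>a\<in>F. of_real (cmod (w a)) * g a)"
      using F by (intro sum.mono_neutral_cong_left) (auto simp: scaleR_conv_of_real)
    finally show ?thesis .
  qed
  have "locally_finite_complex_measure \<nu>"
    unfolding locally_finite_complex_measure_def \<nu>_def
    by (auto intro!: sums_disjoint_family finite_uniform_discrete_bounded[OF A])
  moreover have "polar_decomposition \<nu> M h"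
    unfolding polar_decomposition_def
  proof (intro conjI allI impI ballI h norm_h)
    fix K :: "'a set" assume "compact K"
    then have K: "finite (A \<inter> K)" "K \<in> sets borel"
      by (auto intro: finite_uniform_discrete_bounded[OF A] compact_imp_bounded borel_compact)
    have "emeasure M K = emeasure (density (count_space A) (\<lambda>a. ennreal (cmod (w a)))) (K \<inter> A)"
      unfolding M_def by (subst emeasure_distr[OF id]) (use K in auto)
    also have "\<dots> = (\<integral>\<^sup>+a. ennreal (cmod (w a)) * indicator (K \<inter> A) a \<partial>count_space A)"
      by (rule emeasure_density) auto
    also have "\<dots> = (\<Sum>a | a \<in> A \<and> 0 < ennreal (cmod (w a)) * indicator (K \<inter> A) a.
        ennreal (cmod (w a)) * indicator (K \<inter> A) a)"
      by (rule nn_integral_count_space) (rule finite_subset[OF _ K(1)], auto simp: indicator_def split: if_splits)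
    also have "\<dots> < \<infinity>"
      by (auto simp: ennreal_mult_less_top indicator_def)
    finally show "emeasure M K < \<infinity>" .
  next
    fix E :: "'a set" assume E: "E \<in> sets borel" "bounded E"
    have "(LINT x:E|M. h x) = (\<Sum>a\<in>A \<inter> E. of_real (cmod (w a)) * (indicator E a *\<^sub>R h a))"
      unfolding set_lebesgue_integral_def
      by (rule integral_M) (use E finite_uniform_discrete_bounded[OF A] in auto)
    also have "\<dots> = \<nu> E"
      unfolding \<nu>_def by (intro sum.cong) (auto simp: wh)
    finally show "\<nu> E = (LINT x:E|M. h x)" ..
  qed (simp add: M_def)
  moreover have "T f = (\<integral>x. cnj (f x) * h x \<partial>M)" if f: "test_function f" for f
  proof -
    obtain R where R: "\<And>x. norm x > R \<Longrightarrow> f x = 0" using f test_function_iff by metis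
    let ?F = "A \<inter> cball 0 R"
    have "f a = 0" if "a \<in> A - ?F" for a
      by (rule R) (use that in auto)
    then have F: "finite ?F" "?F \<subseteq> A" "\<forall>a\<in>A - ?F. f a = 0"
      using finite_uniform_discrete_bounded[OF A bounded_cball] by auto
    have "(\<lambda>x. cnj (f x)) \<in> borel_measurable borel"
      using f by (intro smooth_borel_measurable smooth_cnj test_function_smooth)
    then have m: "(\<lambda>x. cnj (f x) * h x) \<in> borel_measurable borel"
      using h by (rule borel_measurable_times)
    have "(\<integral>x. cnj (f x) * h x \<partial>M) = (\<Sum>a\<in>?F. of_real (cmod (w a)) * (cnj (f a) * h a))"
      by (rule integral_M[OF m F(1,2)]) (use F(3) in simp)
    also have "\<dots> = (\<Sum>a\<in>?F. w a * cnj (f a))"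
    proof (intro sum.cong refl)
      fix a assume "a \<in> ?F"
      have "of_real (cmod (w a)) * (cnj (f a) * h a) = of_real (cmod (w a)) * h a * cnj (f a)"
        by (simp only: mult_ac)
      also have "of_real (cmod (w a)) * h a = w a"
        using wh \<open>a \<in> ?F\<close> by blast
      finally show "of_real (cmod (w a)) * (cnj (f a) * h a) = w a * cnj (f a)" .
    qed
    also have "\<dots> = T f" by (rule T[OF f F, symmetric])
    finally show ?thesis ..
  qed
  ultimately show ?thesis
    unfolding is_measure_distr_def given_by_measure_def
    by (intro exI[of _ \<nu>] exI[of _ M] exI[of _ h] conjI allI impI)
qed

lemma point_masses_support:
  fixes A :: "'a::euclidean_space set" and w :: "'a \<Rightarrow> complex"
  assumes A: "uniform_discrete A"
    and T: "\<And>f F. \<lbrakk>test_function f; finite F; F \<subseteq> A; \<forall>a\<in>A - F. f a = 0\<rbrakk> \<Longrightarrow> T f = (\<Sum>a\<in>F. w a * cnj (f a))"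
  shows "distr_support T \<subseteq> A"
proof -
  have "T f = 0" if "test_function f" "closure {x. f x \<noteq> 0} \<subseteq> - A" for f
    using T[of f "{}"] that closure_subset[of "{x. f x \<noteq> 0}"] by auto
  moreover have "open (- A)" using uniform_discrete_imp_closed[OF A] by (simp add: open_Compl)
  ultimately show ?thesis unfolding distr_support_def by blast
qed

section \<open>The Wigner transform of a distribution\<close>

text \<open>This is Moyal's identity with \<open>\<Phi>\<close> in the role of the cross-Wigner transform of \<open>f\<close> and \<open>g\<close>.\<close>

lemma wigner_rank_one:
  assumes \<mu>: "tempered \<mu>" and f: "schwartz f" and g: "schwartz g"
    and eq: "inv_fourier_snd \<Phi> = sym_coord (\<lambda>(y, z). f y * cnj (g z))"
  shows "wigner \<mu> \<Phi> = \<mu> f * cnj (\<mu> g)"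
proof -
  have scale: "\<mu> (\<lambda>x. c * \<phi> x) = cnj c * \<mu> \<phi>" if "schwartz \<phi>" for c \<phi>
    using \<mu> that by (simp add: tempered_def)
  have "conj_distr \<mu> (\<lambda>z. f y * cnj (g z)) = cnj (f y * \<mu> g)" for y
    using scale[OF g, of "cnj (f y)"] by (simp add: conj_distr_def)
  then have "wigner \<mu> \<Phi> = \<mu> (\<lambda>y. \<mu> g * f y)"
    by (simp add: wigner_def cross_wigner_def tensor_distr_def eq inv_sym_coord_sym_coord mult.commute)
  then show ?thesis by (simp add: scale[OF f] mult.commute)
qed

lemma distr_has_sum_dirac_determined:
  assumes "distr_has_sum (\<lambda>(r, s) \<phi>. c r s * dirac (r, s) \<phi>) W (A \<times> B)"
    and "schwartz \<Phi>" "schwartz \<Psi>" and "\<And>r s. r \<in> A \<Longrightarrow> s \<in> B \<Longrightarrow> \<Phi> (r, s) = \<Psi> (r, s)"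
  shows "W \<Phi> = W \<Psi>"
proof -
  have "((\<lambda>(r, s). c r s * dirac (r, s) \<Phi>) has_sum W \<Phi>) (A \<times> B)"
    "((\<lambda>(r, s). c r s * dirac (r, s) \<Psi>) has_sum W \<Psi>) (A \<times> B)"
    using assms(1-3) by (simp_all add: distr_has_sum_def case_prod_unfold)
  moreover have "((\<lambda>(r, s). c r s * dirac (r, s) \<Phi>) has_sum W \<Phi>) (A \<times> B) \<longleftrightarrow>
      ((\<lambda>(r, s). c r s * dirac (r, s) \<Psi>) has_sum W \<Phi>) (A \<times> B)"
    by (rule has_sum_cong) (auto simp: dirac_def assms(4))
  ultimately show ?thesis using has_sum_unique by blast
qed

lemma test_function_sym_coord_tensor:
  fixes f g :: "'a::euclidean_space \<Rightarrow> complex"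
  assumes "test_function f" "test_function g"
  shows "test_function (sym_coord (\<lambda>(y, z). f y * cnj (g z)))"
proof -
  define L where "L = (\<lambda>(x, t). (x + t /\<^sub>R 2, x - t /\<^sub>R 2 :: 'a))"
  have "linear L" by (auto intro!: linearI simp: L_def algebra_simps)
  moreover have "norm y \<le> 3 * norm (L y)" for y
  proof -
    obtain x t where y: "y = (x, t)" by force
    define p q where "p = x + t /\<^sub>R 2" and "q = x - t /\<^sub>R 2"
    have pq: "x = (p + q) /\<^sub>R 2" "t = p - q"
      by (simp_all add: p_def q_def scaleR_2[symmetric] flip: scaleR_add_left)
    have "norm y \<le> norm x + norm t" unfolding y by (rule norm_Pair_le)
    moreover have "norm x \<le> (norm p + norm q) / 2" unfolding pq using norm_triangle_ineq[of p q] by simp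
    moreover have "norm t \<le> norm p + norm q" unfolding pq by (rule norm_triangle_ineq4)
    ultimately have "norm y \<le> 3 / 2 * (norm p + norm q)" by argo
    also have "\<dots> \<le> 3 / 2 * (norm (L y) + norm (L y))"
      using norm_fst_le[of p q] norm_snd_le[of q p]
      by (intro mult_left_mono add_mono) (simp_all add: L_def y p_def q_def)
    finally show ?thesis by simp
  qed
  ultimately have "test_function (\<lambda>y. (\<lambda>(y, z). f y * cnj (g z)) (L y))"
    by (rule test_function_linear_iso[OF test_function_tensor[OF assms(1) test_function_cnj[OF assms(2)]]])
  moreover have "(\<lambda>y. (\<lambda>(y, z). f y * cnj (g z)) (L y)) = sym_coord (\<lambda>(y, z). f y * cnj (g z))"
    by (auto simp: sym_coord_def L_def)
  ultimately show ?thesis by simp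
qed

lemma inv_fourier_snd_partial_fourier:
  assumes "test_function F"
  shows "inv_fourier_snd (partial_fourier F) = F"
  by (auto simp: inv_fourier_snd_def partial_fourier_def fourier_inversion[OF test_function_slice[OF assms]])

lemma character_add: "character (s + t) = character s * character t"
  by (simp add: algebra_simps flip: exp_add)

lemma cnj_character: "cnj (character s) = character (- s)"
  by (simp add: exp_cnj)

text \<open>The cross-Wigner transform of the inverse Fourier transforms of \<open>f\<close> and \<open>g\<close> at \<open>(x, \<omega>)\<close> is that of
  \<open>f\<close> and \<open>g\<close> at \<open>(\<omega>, - x)\<close>.  With \<open>u = \<omega> + \<eta>/2\<close> and \<open>v = \<omega> - \<eta>/2\<close>, the phase separates,
  \<open>x \<bullet> \<eta> + t \<bullet> \<omega> = (x + t/2) \<bullet> u - (x - t/2) \<bullet> v\<close>, and the double integral becomes a product.  The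
  substitution is carried out in two steps, \<open>\<omega>\<close> to \<open>u\<close> for fixed \<open>\<eta>\<close> and \<open>\<eta>\<close> to \<open>v = u - \<eta>\<close> for fixed
  \<open>u\<close>, each of which preserves Lebesgue measure.\<close>

lemma inv_fourier_snd_rotated_partial_fourier:
  fixes f g :: "'a::euclidean_space \<Rightarrow> complex"
  assumes f: "test_function f" and g: "test_function g"
  shows "inv_fourier_snd (\<lambda>(x, \<omega>). partial_fourier (sym_coord (\<lambda>(y, z). f y * cnj (g z))) (\<omega>, - x))
    = sym_coord (\<lambda>(y, z). inv_fourier f y * cnj (inv_fourier g z))"
proof (rule ext, clarify)
  fix x t :: 'a
  let ?F = "sym_coord (\<lambda>(y, z). f y * cnj (g z))"
  let ?k = "\<lambda>\<omega> \<eta>. character (- x \<bullet> \<eta>) * character (- t \<bullet> \<omega>)"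
  have cf: "continuous_on UNIV f" and cg: "continuous_on UNIV g"
    using f g by (auto intro: smooth_continuous_on test_function_smooth)
  have "inv_fourier_snd (\<lambda>(x, \<omega>). partial_fourier ?F (\<omega>, - x)) (x, t)
      = (\<integral>\<omega>. (\<integral>\<eta>. ?F (\<omega>, \<eta>) * character (- x \<bullet> \<eta>) \<partial>lborel) * character (- t \<bullet> \<omega>) \<partial>lborel)"
    unfolding inv_fourier_snd_def partial_fourier_def inv_fourier_def fourier_def prod.case ..
  also have "\<dots> = (\<integral>\<omega>. \<integral>\<eta>. ?F (\<omega>, \<eta>) * ?k \<omega> \<eta> \<partial>lborel \<partial>lborel)"
    unfolding mult.assoc[symmetric] integral_mult_left_zero ..
  also have "\<dots> = (\<integral>\<eta>. \<integral>\<omega>. ?F (\<omega>, \<eta>) * ?k \<omega> \<eta> \<partial>lborel \<partial>lborel)"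
  proof (rule lborel_pair.Fubini_integral[symmetric])
    have tF: "test_function ?F" by (rule test_function_sym_coord_tensor[OF f g])
    obtain R where R: "\<And>y. norm y > R \<Longrightarrow> ?F y = 0" using tF test_function_iff by metis
    have "integrable lborel (\<lambda>y. ?F y * ?k (fst y) (snd y))"
    proof (rule integrable_continuous_bounded_support)
      show "continuous_on UNIV (\<lambda>y. ?F y * ?k (fst y) (snd y))"
        by (intro continuous_on_mult[OF smooth_continuous_on[OF test_function_smooth[OF tF]]] continuous_intros)
    qed (use R in simp)
    then show "integrable (lborel \<Otimes>\<^sub>M lborel) (\<lambda>(\<omega>, \<eta>). ?F (\<omega>, \<eta>) * ?k \<omega> \<eta>)"
      by (simp only: lborel_prod case_prod_unfold prod.collapse)
  qed
  also have "\<dots> = (\<integral>\<eta>. \<integral>u. f u * (cnj (g (u - \<eta>)) * ?k (u - \<eta> /\<^sub>R 2) \<eta>) \<partial>lborel \<partial>lborel)"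
  proof (rule Bochner_Integration.integral_cong[OF refl])
    fix \<eta> :: 'a
    let ?h = "\<lambda>u. f u * (cnj (g (u - \<eta>)) * ?k (u - \<eta> /\<^sub>R 2) \<eta>)"
    have "?h \<in> borel_measurable borel"
      by (intro borel_measurable_continuous_onI continuous_on_mult cf continuous_on_cnj
          continuous_on_compose2[OF cg] continuous_intros) auto
    from lborel_integral_translate[OF this, of "\<eta> /\<^sub>R 2"]
    have "(\<integral>\<omega>. ?h (\<eta> /\<^sub>R 2 + \<omega>) \<partial>lborel) = (\<integral>u. ?h u \<partial>lborel)" .
    moreover have "?h (\<eta> /\<^sub>R 2 + \<omega>) = ?F (\<omega>, \<eta>) * ?k \<omega> \<eta>" for \<omega>
    proof -
      have half: "\<eta> /\<^sub>R 2 + \<omega> - \<eta> = \<omega> - \<eta> /\<^sub>R 2" "\<eta> /\<^sub>R 2 + \<omega> - \<eta> /\<^sub>R 2 = \<omega>"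
        using scaleR_half_double[of \<eta>] by (simp_all add: algebra_simps flip: scaleR_add_left)
      show ?thesis unfolding half by (simp only: sym_coord_def prod.case add.commute mult.assoc)
    qed
    ultimately show "(\<integral>\<omega>. ?F (\<omega>, \<eta>) * ?k \<omega> \<eta> \<partial>lborel) = (\<integral>u. ?h u \<partial>lborel)" by (simp only:)
  qed
  also have "\<dots> = (\<integral>u. \<integral>\<eta>. f u * (cnj (g (u - \<eta>)) * ?k (u - \<eta> /\<^sub>R 2) \<eta>) \<partial>lborel \<partial>lborel)"
  proof (rule lborel_pair.Fubini_integral)
    obtain R S where R: "\<And>y. norm y > R \<Longrightarrow> f y = 0" and S: "\<And>y. norm y > S \<Longrightarrow> g y = 0"
      using f g test_function_iff by metis
    have "integrable lborel (\<lambda>y. f (fst y) * (cnj (g (fst y - snd y)) * ?k (fst y - snd y /\<^sub>R 2) (snd y)))"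
    proof (rule integrable_continuous_bounded_support)
      show "continuous_on UNIV (\<lambda>y. f (fst y) * (cnj (g (fst y - snd y)) * ?k (fst y - snd y /\<^sub>R 2) (snd y)))"
        by (intro continuous_on_mult continuous_on_cnj continuous_on_compose2[OF cg]
            continuous_on_compose2[OF cf] continuous_intros) auto
      fix y :: "'a \<times> 'a" assume y: "norm y > 2 * R + S"
      have "norm y \<le> norm (fst y) + norm (snd y)" using norm_Pair_le[of "fst y" "snd y"] by simp
      moreover have "norm (snd y) \<le> norm (fst y) + norm (fst y - snd y)"
        by (metis norm_minus_commute norm_triangle_sub)
      ultimately have "norm (fst y) > R \<or> norm (fst y - snd y) > S" using y by linarith
      then show "f (fst y) * (cnj (g (fst y - snd y)) * ?k (fst y - snd y /\<^sub>R 2) (snd y)) = 0"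
        using R S by auto
    qed
    then show "integrable (lborel \<Otimes>\<^sub>M lborel) (\<lambda>(u, \<eta>). f u * (cnj (g (u - \<eta>)) * ?k (u - \<eta> /\<^sub>R 2) \<eta>))"
      by (simp only: lborel_prod case_prod_unfold prod.collapse)
  qed
  also have "\<dots> = (\<integral>u. f u * (character (- (x + t /\<^sub>R 2) \<bullet> u) * cnj (inv_fourier g (x - t /\<^sub>R 2))) \<partial>lborel)"
  proof (rule Bochner_Integration.integral_cong[OF refl])
    fix u :: 'a
    have "(\<integral>\<eta>. cnj (g (u - \<eta>)) * ?k (u - \<eta> /\<^sub>R 2) \<eta> \<partial>lborel)
        = of_real (\<bar>- 1\<bar> ^ DIM('a)) * (\<integral>v. cnj (g (u - (u + (- 1) *\<^sub>R v)))
          * ?k (u - (u + (- 1) *\<^sub>R v) /\<^sub>R 2) (u + (- 1) *\<^sub>R v) \<partial>lborel)"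
      by (rule lborel_integral_affine)
        (auto intro!: borel_measurable_continuous_onI continuous_on_mult continuous_on_cnj
          continuous_on_compose2[OF cg] continuous_intros)
    also have "(\<lambda>v. cnj (g (u - (u + (- 1) *\<^sub>R v))) * ?k (u - (u + (- 1) *\<^sub>R v) /\<^sub>R 2) (u + (- 1) *\<^sub>R v))
        = (\<lambda>v. character (- (x + t /\<^sub>R 2) \<bullet> u) * cnj (g v * character (- (x - t /\<^sub>R 2) \<bullet> v)))"
    proof
      fix v
      have eq: "- x \<bullet> (u + (- 1) *\<^sub>R v) + - t \<bullet> (u - (u + (- 1) *\<^sub>R v) /\<^sub>R 2)
          = - (x + t /\<^sub>R 2) \<bullet> u + - (- (x - t /\<^sub>R 2) \<bullet> v)"
        by (simp add: algebra_simps inner_simps)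
      show "cnj (g (u - (u + (- 1) *\<^sub>R v))) * ?k (u - (u + (- 1) *\<^sub>R v) /\<^sub>R 2) (u + (- 1) *\<^sub>R v)
          = character (- (x + t /\<^sub>R 2) \<bullet> u) * cnj (g v * character (- (x - t /\<^sub>R 2) \<bullet> v))"
        unfolding complex_cnj_mult cnj_character character_add[symmetric] eq
        unfolding character_add by simp
    qed
    also have "(\<integral>v. character (- (x + t /\<^sub>R 2) \<bullet> u) * cnj (g v * character (- (x - t /\<^sub>R 2) \<bullet> v)) \<partial>lborel)
        = character (- (x + t /\<^sub>R 2) \<bullet> u) * cnj (inv_fourier g (x - t /\<^sub>R 2))"
      unfolding inv_fourier_def fourier_def integral_mult_right_zero Bochner_Integration.integral_cnj ..
    finally have inner: "(\<integral>\<eta>. cnj (g (u - \<eta>)) * ?k (u - \<eta> /\<^sub>R 2) \<eta> \<partial>lborel)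
        = character (- (x + t /\<^sub>R 2) \<bullet> u) * cnj (inv_fourier g (x - t /\<^sub>R 2))"
      by simp
    show "(\<integral>\<eta>. f u * (cnj (g (u - \<eta>)) * ?k (u - \<eta> /\<^sub>R 2) \<eta>) \<partial>lborel)
        = f u * (character (- (x + t /\<^sub>R 2) \<bullet> u) * cnj (inv_fourier g (x - t /\<^sub>R 2)))"
      unfolding integral_mult_right_zero inner ..
  qed
  also have "\<dots> = inv_fourier f (x + t /\<^sub>R 2) * cnj (inv_fourier g (x - t /\<^sub>R 2))"
    unfolding mult.assoc[symmetric] integral_mult_left_zero inv_fourier_def fourier_def[of f] ..
  also have "\<dots> = sym_coord (\<lambda>(y, z). inv_fourier f y * cnj (inv_fourier g z)) (x, t)"
    by (simp add: sym_coord_def)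
  finally show "inv_fourier_snd (\<lambda>(x, \<omega>). partial_fourier ?F (\<omega>, - x)) (x, t)
      = sym_coord (\<lambda>(y, z). inv_fourier f y * cnj (inv_fourier g z)) (x, t)" .
qed

lemma partial_fourier_sym_coord_cong:
  fixes f g f' g' :: "'a::euclidean_space \<Rightarrow> complex"
  assumes "\<And>t. f (a + t) * cnj (g (a - t)) = f' (a + t) * cnj (g' (a - t))"
  shows "partial_fourier (sym_coord (\<lambda>(y, z). f y * cnj (g z))) (a, \<omega>)
    = partial_fourier (sym_coord (\<lambda>(y, z). f' y * cnj (g' z))) (a, \<omega>)"
  by (simp add: partial_fourier_def sym_coord_def assms)

lemma inv_fourier_add:
  fixes f g :: "'a::euclidean_space \<Rightarrow> complex"
  assumes "test_function f" "test_function g"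
  shows "inv_fourier (\<lambda>x. f x + g x) = (\<lambda>x. inv_fourier f x + inv_fourier g x)"
proof
  fix x :: 'a
  have int: "integrable lborel (\<lambda>t. h t * character (- x \<bullet> t))" if "test_function h" for h
    using smooth_modulation[of "\<lambda>_. 1" "- x"] test_function_mult[OF that]
    by (intro test_function_integrable) (simp add: smooth_const)
  show "inv_fourier (\<lambda>x. f x + g x) x = inv_fourier f x + inv_fourier g x"
    unfolding inv_fourier_def fourier_def distrib_right
    by (intro Bochner_Integration.integral_add int assms)
qed

lemma inv_fourier_cmult: "inv_fourier (\<lambda>x. c * f x) = (\<lambda>x. c * inv_fourier f x)"
  unfolding inv_fourier_def fourier_def mult.assoc integral_mult_right_zero ..

text \<open>Here \<open>\<Phi>\<close> is the cross-Wigner transform of \<open>f\<close> and \<open>g\<close>; over a point \<open>a\<close> of \<open>A\<close> it is the Fourier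
  transform of the symmetric product about \<open>a\<close>.\<close>

lemma symmetric_product_functional_distr:
  assumes "uniform_discrete A" "tempered \<mu>"
    and W: "distr_has_sum (\<lambda>(r, s) \<phi>. c r s * dirac (r, s) \<phi>) (wigner \<mu>) (A \<times> B)"
  shows "symmetric_product_functional \<mu> A"
proof
  fix f g f' g' :: "'a \<Rightarrow> complex"
  assume t: "test_function f" "test_function g" "test_function f'" "test_function g'"
    and eq: "\<And>a t. a \<in> A \<Longrightarrow> f (a + t) * cnj (g (a - t)) = f' (a + t) * cnj (g' (a - t))"
  let ?\<Phi> = "\<lambda>f g :: 'a \<Rightarrow> complex. partial_fourier (sym_coord (\<lambda>(y, z). f y * cnj (g z)))"
  have rank_one: "wigner \<mu> (?\<Phi> f g) = \<mu> f * cnj (\<mu> g)" if "test_function f" "test_function g" for f g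
    by (rule wigner_rank_one[OF assms(2)])
      (use that in \<open>auto intro: test_function_schwartz inv_fourier_snd_partial_fourier test_function_sym_coord_tensor\<close>)
  have "wigner \<mu> (?\<Phi> f g) = wigner \<mu> (?\<Phi> f' g')"
    by (rule distr_has_sum_dirac_determined[OF W])
      (use t eq in \<open>auto intro: partial_fourier_schwartz test_function_sym_coord_tensor partial_fourier_sym_coord_cong\<close>)
  then show "\<mu> f * cnj (\<mu> g) = \<mu> f' * cnj (\<mu> g')" using rank_one t by simp
qed (use assms in \<open>auto simp: tempered_def test_function_schwartz\<close>)

text \<open>Here \<open>\<Phi>\<close> is the cross-Wigner transform of the inverse Fourier transforms of \<open>f\<close> and \<open>g\<close>; at a
  frequency \<open>b\<close> in \<open>B\<close> it is determined by the symmetric product of \<open>f\<close> and \<open>g\<close> about \<open>b\<close>.\<close>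

lemma symmetric_product_functional_fourier_distr:
  assumes "uniform_discrete B" and \<mu>: "tempered \<mu>"
    and W: "distr_has_sum (\<lambda>(r, s) \<phi>. c r s * dirac (r, s) \<phi>) (wigner \<mu>) (A \<times> B)"
  shows "symmetric_product_functional (fourier_distr \<mu>) B"
proof
  fix f g :: "'a \<Rightarrow> complex"
  assume "test_function f" "test_function g"
  then show "fourier_distr \<mu> (\<lambda>x. f x + g x) = fourier_distr \<mu> f + fourier_distr \<mu> g"
    using \<mu> by (simp add: fourier_distr_def inv_fourier_add inv_fourier_schwartz tempered_def)
next
  fix f :: "'a \<Rightarrow> complex" and c
  assume "test_function f"
  then show "fourier_distr \<mu> (\<lambda>x. c * f x) = cnj c * fourier_distr \<mu> f"
    using \<mu> by (simp add: fourier_distr_def inv_fourier_cmult inv_fourier_schwartz tempered_def)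
next
  fix f g f' g' :: "'a \<Rightarrow> complex"
  assume t: "test_function f" "test_function g" "test_function f'" "test_function g'"
    and eq: "\<And>a t. a \<in> B \<Longrightarrow> f (a + t) * cnj (g (a - t)) = f' (a + t) * cnj (g' (a - t))"
  let ?\<Phi> = "\<lambda>f g :: 'a \<Rightarrow> complex. \<lambda>(x, \<omega>). partial_fourier (sym_coord (\<lambda>(y, z). f y * cnj (g z))) (\<omega>, - x)"
  have schwartz: "schwartz (?\<Phi> f g)" if "test_function f" "test_function g" for f g
  proof -
    define L where "L = (\<lambda>(x :: 'a, \<omega> :: 'a). (\<omega>, - x))"
    have "schwartz (\<lambda>y. partial_fourier (sym_coord (\<lambda>(y, z). f y * cnj (g z))) (L y))"
    proof (rule schwartz_compose_isometry[OF partial_fourier_schwartz[OF test_function_sym_coord_tensor[OF that]]])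
      show "linear L" by (auto intro!: linearI simp: L_def)
    qed (auto simp: L_def norm_Pair add.commute Basis_prod_def)
    moreover have "(\<lambda>y. partial_fourier (sym_coord (\<lambda>(y, z). f y * cnj (g z))) (L y)) = ?\<Phi> f g"
      by (auto simp: L_def)
    ultimately show ?thesis by simp
  qed
  have rank_one: "wigner \<mu> (?\<Phi> f g) = fourier_distr \<mu> f * cnj (fourier_distr \<mu> g)"
    if "test_function f" "test_function g" for f g
    unfolding fourier_distr_def
    by (rule wigner_rank_one[OF \<mu> inv_fourier_schwartz inv_fourier_schwartz
          inv_fourier_snd_rotated_partial_fourier]) (use that in auto)
  have "wigner \<mu> (?\<Phi> f g) = wigner \<mu> (?\<Phi> f' g')"
    by (rule distr_has_sum_dirac_determined[OF W])
      (use t eq in \<open>auto intro: schwartz partial_fourier_sym_coord_cong\<close>)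
  then show "fourier_distr \<mu> f * cnj (fourier_distr \<mu> g) = fourier_distr \<mu> f' * cnj (fourier_distr \<mu> g')"
    using rank_one t by simp
qed (rule assms(1))

theorem theorem1:
  fixes A B :: "'a::euclidean_space set"
    and \<mu> :: "'a distr"
    and c :: "'a \<Rightarrow> 'a \<Rightarrow> complex"
  assumes "uniform_discrete A" and "uniform_discrete B"
    and "tempered \<mu>"
    and "distr_has_sum (\<lambda>(r, s) \<phi>. c r s * dirac (r, s) \<phi>) (wigner \<mu>) (A \<times> B)"
  shows "is_measure_distr \<mu> \<and> is_measure_distr (fourier_distr \<mu>) \<and>
         distr_support \<mu> \<subseteq> A \<and> distr_support (fourier_distr \<mu>) \<subseteq> B"
proof -
  have *: "is_measure_distr T \<and> distr_support T \<subseteq> D"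
    if "symmetric_product_functional T D" for T and D :: "'a set"
  proof -
    interpret symmetric_product_functional T D by (rule that)
    obtain w where w: "\<And>f F. test_function f \<Longrightarrow> finite F \<Longrightarrow> F \<subseteq> D \<Longrightarrow> \<forall>a\<in>D - F. f a = 0
        \<Longrightarrow> T f = (\<Sum>a\<in>F. w a * cnj (f a))"
      using combination_of_point_masses by blast
    show ?thesis
      using point_masses_is_measure_distr[OF uniform_discrete w] point_masses_support[OF uniform_discrete w]
      by blast
  qed
  show ?thesis
    using *[OF symmetric_product_functional_distr[OF assms(1,3,4)]]
      *[OF symmetric_product_functional_fourier_distr[OF assms(2,3,4)]] by blast
qed

end
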